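(* Let $n\in\mathbb{N}$, $k\geq2$, $u\equiv a_{i_1}a_{i_2}\cdots a_{i_k}$ and letters $x,y$, with $x,y,a_{i_1},\dots,a_{i_k}\in\{a_1,\dots,a_n\}$, and let $S=sgp^+\langle a_1,\dots,a_n\mid u=xy\rangle$, where $\{u=xy\}$ is a Gröbner–Shirshov basis. If $a_{i_{k-1}}a_{i_k}\not\equiv xy$ and $u\not\equiv y^{k-1}x$, then $S$ is automatic and $S^1$ is prefix-automatic.
   Context: $A^*$ is the free monoid (empty word $\varepsilon$), $A^+=A^*\setminus\{\varepsilon\}$, $\equiv$ is equality of words. $sgp^+\langle A\mid R\rangle$ is $A^+$ modulo the congruence generated by $R$. For $S=sgp^+\langle A\mid R\rangle$, $S^1=sgp^+\langle A\cup\{e\}\mid R,\ ea=ae=a\ (a\in A),\ ee=e\rangle$ ($e$ a new letter, the identity of $S^1$). Gröbner–Shirshov bases: fix a well-ordering of $A$ and the deg-lex ordering on $A^*$ (length, then lexicographic). For monic polynomials $f,g$ in the free associative algebra $F\langle A\rangle$ over a field with leading words $\bar f,\bar g$: if $w\equiv\bar f b\equiv a\bar g$ with $|\bar f|+|\bar g|>|w|$, $(f,g)_w=fb-ag$; if $w\equiv\bar f\equiv a\bar g b$, $(f,g)_w=f-agb$; trivial modulo $(R,w)$ if it equals $\sum\alpha_i a_i s_i b_i$ with $s_i\in R$, $a_i\bar{s_i}b_i<w$. $R$ is a Gröbner–Shirshov basis if all compositions are trivial; $\{u=xy\}$ is one if $\{u-xy\}$ is. Automaticity: regular = accepted by a finite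 automaton. With $\$\notin A$, $A(2,\$)=(A\cup\{\$\})^2\setminus\{(\$,\$)\}$; $(\alpha,\beta)\delta_A^R$ is the word over $A(2,\$)$ obtained by padding the shorter word on the right with $\$$'s and reading letter pairs. For a semigroup generated by finite $A$, $\phi:A^+\to S$ canonical, $L\subseteq A^+$ regular with $\phi(L)=S$, write $\alpha=\beta$ if $\phi(\alpha)=\phi(\beta)$ and $L_a^\$=\{(\alpha,\beta)\delta^R_A:\alpha,\beta\in L,\alpha a=\beta\}$ for $a\in A\cup\{\varepsilon\}$. $S$ is automatic if some such $(A,L)$ has all $L_a^\$$ regular; prefix-automatic if some such automatic structure also has $\{(\alpha,\beta)\delta_A^R:\alpha\in L,\beta\in\mathrm{Pref}(L),\alpha=\beta\}$ regular ($\mathrm{Pref}(L)$ = prefixes of words of $L$). *)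

theory Defs
  imports Main
begin

inductive_set congr_gen :: "('a list \<times> 'a list) set \<Rightarrow> ('a list \<times> 'a list) set"
  for R :: "('a list \<times> 'a list) set" where
  base: "(u, v) \<in> R \<Longrightarrow> (p @ u @ q, p @ v @ q) \<in> congr_gen R"
| refl: "(w, w) \<in> congr_gen R"
| sym: "(u, v) \<in> congr_gen R \<Longrightarrow> (v, u) \<in> congr_gen R"
| trans: "(u, v) \<in> congr_gen R \<Longrightarrow> (v, w) \<in> congr_gen R \<Longrightarrow> (u, w) \<in> congr_gen R"

definition cls :: "'a set \<Rightarrow> ('a list \<times> 'a list) set \<Rightarrow> 'a list \<Rightarrow> 'a list set" where
  "cls A R w = {v \<in> lists A. (w, v) \<in> congr_gen R}"

definition sgp_carrier :: "'a set \<Rightarrow> ('a list \<times> 'a list) set \<Rightarrow> 'a list set set" where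
  "sgp_carrier A R = cls A R ` (lists A - {[]})"

definition sgp_mult :: "'a set \<Rightarrow> ('a list \<times> 'a list) set \<Rightarrow> 'a list set \<Rightarrow> 'a list set \<Rightarrow> 'a list set" where
  "sgp_mult A R X Y = cls A R ((SOME w. w \<in> X) @ (SOME w. w \<in> Y))"

text \<open>S^1: adjoin a new letter e (here the letter 0, assumed not in A) with
  relations e a = a e = a (a in A), e e = e.\<close>
definition one_alph :: "nat set \<Rightarrow> nat set" where
  "one_alph A = insert 0 A"

definition one_rels :: "nat set \<Rightarrow> (nat list \<times> nat list) set \<Rightarrow> (nat list \<times> nat list) set" where
  "one_rels A R = R \<union> {([0, a], [a]) | a. a \<in> A} \<union> {([a, 0], [a]) | a. a \<in> A} \<union> {([0, 0], [0])}"

text \<open>Deg-lex ordering on words, for a well-ordering of the (finite) alphabet given by an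
  injective rank function rho.\<close>
definition dlex_less :: "(nat \<Rightarrow> nat) \<Rightarrow> nat list \<Rightarrow> nat list \<Rightarrow> bool" where
  "dlex_less \<rho> v w \<longleftrightarrow> length v < length w \<or>
     (length v = length w \<and> (v, w) \<in> lexord {(a, b). \<rho> a < \<rho> b})"

text \<open>Noncommutative polynomials are represented by their coefficient functions on words.\<close>
definition poly_over :: "nat set \<Rightarrow> (nat list \<Rightarrow> 'k::field) \<Rightarrow> bool" where
  "poly_over A f \<longleftrightarrow> finite {w. f w \<noteq> 0} \<and> {w. f w \<noteq> 0} \<subseteq> lists A"

definition is_lead :: "(nat \<Rightarrow> nat) \<Rightarrow> (nat list \<Rightarrow> 'k::field) \<Rightarrow> nat list \<Rightarrow> bool" where
  "is_lead \<rho> f w \<longleftrightarrow> f w \<noteq> 0 \<and> (\<forall>v. f v \<noteq> 0 \<longrightarrow> v = w \<or> dlex_less \<rho> v w)"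

definition lead :: "(nat \<Rightarrow> nat) \<Rightarrow> (nat list \<Rightarrow> 'k::field) \<Rightarrow> nat list" where
  "lead \<rho> f = (THE w. is_lead \<rho> f w)"

definition monic :: "(nat \<Rightarrow> nat) \<Rightarrow> (nat list \<Rightarrow> 'k::field) \<Rightarrow> bool" where
  "monic \<rho> f \<longleftrightarrow> (\<exists>w. is_lead \<rho> f w \<and> f w = 1)"

definition wmul :: "nat list \<Rightarrow> (nat list \<Rightarrow> 'k::field) \<Rightarrow> nat list \<Rightarrow> nat list \<Rightarrow> 'k" where
  "wmul a f b w = (if \<exists>v. w = a @ v @ b then f (THE v. w = a @ v @ b) else 0)"

definition trivial_mod :: "(nat \<Rightarrow> nat) \<Rightarrow> nat set \<Rightarrow> (nat list \<Rightarrow> 'k::field) set \<Rightarrow> nat list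
    \<Rightarrow> (nat list \<Rightarrow> 'k) \<Rightarrow> bool" where
  "trivial_mod \<rho> A R w h \<longleftrightarrow>
     (\<exists>(m::nat) (\<alpha>::nat \<Rightarrow> 'k) a s b.
        (\<forall>i<m. s i \<in> R \<and> a i \<in> lists A \<and> b i \<in> lists A \<and>
               dlex_less \<rho> (a i @ lead \<rho> (s i) @ b i) w) \<and>
        (\<forall>v. h v = (\<Sum>i<m. \<alpha> i * wmul (a i) (s i) (b i) v)))"

definition GSB :: "(nat \<Rightarrow> nat) \<Rightarrow> nat set \<Rightarrow> (nat list \<Rightarrow> 'k::field) set \<Rightarrow> bool" where
  "GSB \<rho> A R \<longleftrightarrow>
     (\<forall>f\<in>R. poly_over A f \<and> monic \<rho> f) \<and>
     (\<forall>f\<in>R. \<forall>g\<in>R. \<forall>w a b. a \<in> lists A \<and> b \<in> lists A \<longrightarrow>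
        ((w = lead \<rho> f @ b \<and> w = a @ lead \<rho> g \<and>
          length (lead \<rho> f) + length (lead \<rho> g) > length w)
           \<longrightarrow> trivial_mod \<rho> A R w (\<lambda>v. wmul [] f b v - wmul a g [] v)) \<and>
        ((w = lead \<rho> f \<and> w = a @ lead \<rho> g @ b)
           \<longrightarrow> trivial_mod \<rho> A R w (\<lambda>v. f v - wmul a g b v)))"

definition regular :: "'b set \<Rightarrow> 'b list set \<Rightarrow> bool" where
  "regular \<Sigma> L \<longleftrightarrow> L \<subseteq> lists \<Sigma> \<and>
     (\<exists>(Q::nat set) q0 (\<delta>::nat \<Rightarrow> 'b \<Rightarrow> nat) F. finite Q \<and> q0 \<in> Q \<and>
        (\<forall>q\<in>Q. \<forall>c\<in>\<Sigma>. \<delta> q c \<in> Q) \<and> F \<subseteq> Q \<and>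
        L = {w \<in> lists \<Sigma>. fold (\<lambda>c q. \<delta> q c) w q0 \<in> F})"

fun ev :: "('s \<Rightarrow> 's \<Rightarrow> 's) \<Rightarrow> 's list \<Rightarrow> 's" where
  "ev m [] = undefined"
| "ev m [s] = s"
| "ev m (s # t # ts) = m s (ev m (t # ts))"

fun pad :: "'a list \<Rightarrow> 'a list \<Rightarrow> ('a option \<times> 'a option) list" where
  "pad [] [] = []"
| "pad (a # as) [] = (Some a, None) # pad as []"
| "pad [] (b # bs) = (None, Some b) # pad [] bs"
| "pad (a # as) (b # bs) = (Some a, Some b) # pad as bs"

definition pair_alph :: "'a set \<Rightarrow> ('a option \<times> 'a option) set" where
  "pair_alph A = (insert None (Some ` A) \<times> insert None (Some ` A)) - {(None, None)}"

definition Pref :: "'a list set \<Rightarrow> 'a list set" where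
  "Pref L = {\<beta>. \<exists>\<gamma>. \<beta> @ \<gamma> \<in> L}"

definition auto_structure :: "'s set \<Rightarrow> ('s \<Rightarrow> 's \<Rightarrow> 's) \<Rightarrow> 's set \<Rightarrow> 's list set \<Rightarrow> bool" where
  "auto_structure S m A L \<longleftrightarrow>
     finite A \<and> A \<subseteq> S \<and> L \<subseteq> lists A - {[]} \<and> regular A L \<and> ev m ` L = S \<and>
     regular (pair_alph A) {pad \<alpha> \<beta> | \<alpha> \<beta>. \<alpha> \<in> L \<and> \<beta> \<in> L \<and> ev m \<alpha> = ev m \<beta>} \<and>
     (\<forall>a\<in>A. regular (pair_alph A)
        {pad \<alpha> \<beta> | \<alpha> \<beta>. \<alpha> \<in> L \<and> \<beta> \<in> L \<and> ev m (\<alpha> @ [a]) = ev m \<beta>})"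

definition automatic :: "'s set \<Rightarrow> ('s \<Rightarrow> 's \<Rightarrow> 's) \<Rightarrow> bool" where
  "automatic S m \<longleftrightarrow> (\<exists>A L. auto_structure S m A L)"

definition prefix_automatic :: "'s set \<Rightarrow> ('s \<Rightarrow> 's \<Rightarrow> 's) \<Rightarrow> bool" where
  "prefix_automatic S m \<longleftrightarrow> (\<exists>A L. auto_structure S m A L \<and>
     regular (pair_alph A)
       {pad \<alpha> \<beta> | \<alpha> \<beta>. \<alpha> \<in> L \<and> \<beta> \<in> Pref L \<and> \<beta> \<noteq> [] \<and> ev m \<alpha> = ev m \<beta>})"

end

theory Submission
  imports Defs "HOL-Library.Sublist" "HOL-Library.Confluence"
begin

text \<open>The hypothesis makes the single rule \<open>u \<rightarrow> xy\<close> convergent, so that the words avoiding \<open>u\<close> as a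
  factor represent the elements of the semigroup uniquely. Write \<open>u = vc\<close>. Right multiplication of
  such a word by a letter can trigger more than one rewriting step only if \<open>c = x\<close>, and then it
  turns \<open>\<gamma>v\<^sup>m\<close> into \<open>\<gamma>xy\<^sup>m\<close>. These words have incompatible lengths if \<open>length v > 1\<close>. Therefore
  \<open>v\<close> is added as a generator, and words are coded by replacing occurrences of \<open>v\<close> greedily from the
  left. While a factor \<open>v\<close> is read, exactly one such replacement takes place, so \<open>\<gamma>v\<^sup>m\<close> is coded,
  up to boundedly many letters, as \<open>\<gamma>\<close> followed by \<open>m\<close> copies of the new generator. On the other
  side \<open>y\<^sup>m\<close> stays as it is because \<open>v\<close> is not a power of \<open>y\<close>. The set of codes is closed under
  prefixes, whence prefix-automaticity after adding the identity as one more code word.\<close>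

section \<open>Recognizable languages\<close>

definition lquot :: "'a list \<Rightarrow> 'a list set \<Rightarrow> 'a list set" where
  "lquot w L = {v. w @ v \<in> L}"

definition recognizable :: "'a list set \<Rightarrow> bool" where
  "recognizable L \<longleftrightarrow> finite (range (\<lambda>w. lquot w L))"

lemma lquot_Nil [simp]: "lquot [] L = L"
  by (simp add: lquot_def)

lemma lquot_append: "lquot (v @ w) L = lquot w (lquot v L)"
  by (simp add: lquot_def)

lemma recognizableI: "finite F \<Longrightarrow> (\<And>w. lquot w L \<in> F) \<Longrightarrow> recognizable L"
  unfolding recognizable_def by (rule finite_subset[of _ F]) auto

lemma fold_lquot_transition:
  assumes "inj_on g (range (\<lambda>w. lquot w L))"
  defines "\<delta> \<equiv> \<lambda>c q. g (lquot [c] (inv_into (range (\<lambda>w. lquot w L)) g q))"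
  shows "fold \<delta> w (g L) = g (lquot w L)"
proof (induction w rule: rev_induct)
  case (snoc c w)
  then show ?case using assms(1) by (simp add: \<delta>_def lquot_append)
qed simp

lemma regular_if_recognizable:
  assumes "recognizable L" and sub: "L \<subseteq> lists \<Sigma>"
  shows "regular \<Sigma> L"
proof -
  define Q where "Q = range (\<lambda>w. lquot w L)"
  have "finite Q" using assms(1) by (simp add: recognizable_def Q_def)
  then obtain g :: "'a list set \<Rightarrow> nat" where inj: "inj_on g Q"
    using finite_imp_inj_to_nat_seg by metis
  define \<delta> where "\<delta> q c = g (lquot [c] (inv_into Q g q))" for q c
  let ?F = "g ` {X \<in> Q. [] \<in> X}"
  have quot: "lquot w L \<in> Q" for w by (simp add: Q_def)
  have run: "fold (\<lambda>c q. \<delta> q c) w (g L) = g (lquot w L)" for w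
    using fold_lquot_transition inj unfolding Q_def \<delta>_def .
  have accept: "g (lquot w L) \<in> ?F \<longleftrightarrow> w \<in> L" for w
  proof -
    have "g (lquot w L) \<in> ?F \<longleftrightarrow> lquot w L \<in> {X \<in> Q. [] \<in> X}"
      using inj quot by (intro inj_on_image_mem_iff) auto
    then show ?thesis using quot by (simp add: lquot_def)
  qed
  have "L = {w \<in> lists \<Sigma>. fold (\<lambda>c q. \<delta> q c) w (g L) \<in> ?F}"
    unfolding run accept using sub by auto
  moreover have "\<forall>q\<in>g ` Q. \<forall>c\<in>\<Sigma>. \<delta> q c \<in> g ` Q"
    using inj by (auto simp: \<delta>_def Q_def simp flip: lquot_append)
  moreover have "g L \<in> g ` Q" using quot[of "[]"] by simp
  ultimately show ?thesis
    unfolding regular_def using sub \<open>finite Q\<close>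
    by (intro conjI exI[of _ "g ` Q"] exI[of _ "g L"] exI[of _ \<delta>] exI[of _ ?F]) auto
qed

lemma recognizable_if_lquots:
  assumes "recognizable K" "recognizable L"
    and "\<And>w. \<exists>u v. lquot w M = f (lquot u K) (lquot v L)"
  shows "recognizable M"
proof (rule recognizableI)
  let ?F = "(\<lambda>(X, Y). f X Y) ` (range (\<lambda>w. lquot w K) \<times> range (\<lambda>w. lquot w L))"
  show "finite ?F" using assms(1,2) by (simp add: recognizable_def)
  show "lquot w M \<in> ?F" for w using assms(3)[of w] by auto
qed

lemma recognizable_Un: "recognizable K \<Longrightarrow> recognizable L \<Longrightarrow> recognizable (K \<union> L)"
  by (erule (1) recognizable_if_lquots[where f = "(\<union>)"]) (auto simp: lquot_def)

lemma recognizable_Int: "recognizable K \<Longrightarrow> recognizable L \<Longrightarrow> recognizable (K \<inter> L)"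
  by (erule (1) recognizable_if_lquots[where f = "(\<inter>)"]) (auto simp: lquot_def)

lemma recognizable_Compl: "recognizable L \<Longrightarrow> recognizable (- L)"
  by (rule recognizable_if_lquots[where f = "\<lambda>X _. - X"]) (auto simp: lquot_def)

lemma recognizable_vimage_hom:
  assumes "recognizable L" and "\<And>v w. h (v @ w) = h v @ h w"
  shows "recognizable {w. h w \<in> L}"
proof (rule recognizable_if_lquots[OF assms(1,1)])
  show "\<exists>u v. lquot w {w. h w \<in> L} = {w. h w \<in> lquot u L}" for w
    using assms(2) by (auto simp: lquot_def)
qed

lemma recognizable_rquot: "recognizable L \<Longrightarrow> recognizable {w. \<exists>s\<in>S. w @ s \<in> L}"
  by (rule recognizable_if_lquots[where f = "\<lambda>X _. {w. \<exists>s\<in>S. w @ s \<in> X}"]) (auto simp: lquot_def)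

lemma recognizable_map_image:
  assumes "recognizable L"
  shows "recognizable (map h ` L)"
proof (rule recognizableI)
  let ?F = "(\<lambda>Y. \<Union>X\<in>Y. map h ` X) ` Pow (range (\<lambda>w. lquot w L))"
  show "finite ?F" using assms by (simp add: recognizable_def)
  fix w
  have "lquot w (map h ` L) = (\<Union>X\<in>{lquot v L | v. map h v = w}. map h ` X)"
    by (auto simp: lquot_def append_eq_map_conv image_iff)
  then show "lquot w (map h ` L) \<in> ?F" by (rule image_eqI) auto
qed

lemma recognizable_lists: "recognizable (lists A)"
  by (rule recognizableI[of "{lists A, {}}"]) (auto simp: lquot_def)

lemma recognizable_UNIV: "recognizable UNIV"
  using recognizable_lists[of UNIV] by simp

lemma recognizable_singleton: "recognizable {w}"
proof (rule recognizableI)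
  let ?F = "insert {} ((\<lambda>i. {drop i w}) ` {..length w})"
  show "finite ?F" by simp
  show "lquot v {w} \<in> ?F" for v
  proof (cases "prefix v w")
    case True
    then obtain z where "w = v @ z" by (rule prefixE)
    then have "lquot v {w} = {drop (length v) w}" "length v \<le> length w"
      by (auto simp: lquot_def)
    then show ?thesis by blast
  qed (auto simp: lquot_def prefix_def)
qed

lemma recognizable_UNION:
  "finite I \<Longrightarrow> (\<And>i. i \<in> I \<Longrightarrow> recognizable (L i)) \<Longrightarrow> recognizable (\<Union>i\<in>I. L i)"
proof (induction I rule: finite_induct)
  case empty
  show ?case using recognizable_Compl[OF recognizable_UNIV] by simp
qed (auto intro: recognizable_Un)

lemma recognizable_finite: "finite L \<Longrightarrow> recognizable L"
  using recognizable_UNION[of L "\<lambda>w. {w}", OF _ recognizable_singleton] by simp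

definition lconc :: "'a list set \<Rightarrow> 'a list set \<Rightarrow> 'a list set" where
  "lconc K L = {v @ w | v w. v \<in> K \<and> w \<in> L}"

lemma lquot_lconc:
  "lquot w (lconc K L) = lconc (lquot w K) L \<union> \<Union> {lquot s L | s. \<exists>p\<in>K. w = p @ s}"
    (is "?lhs = ?rhs")
proof (intro equalityI subsetI)
  fix t assume "t \<in> ?lhs"
  then obtain a b where ab: "w @ t = a @ b" "a \<in> K" "b \<in> L" by (auto simp: lquot_def lconc_def)
  then obtain m where "w = a @ m \<and> m @ t = b \<or> w @ m = a \<and> t = m @ b"
    by (auto simp: append_eq_append_conv2)
  then show "t \<in> ?rhs"
  proof
    assume "w = a @ m \<and> m @ t = b"
    then show ?thesis using ab by (intro UnI2 UnionI[of "lquot m L"]) (auto simp: lquot_def)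
  next
    assume "w @ m = a \<and> t = m @ b"
    then show ?thesis using ab by (auto simp: lquot_def lconc_def)
  qed
next
  fix t assume "t \<in> ?rhs"
  then show "t \<in> ?lhs"
  proof
    assume "t \<in> lconc (lquot w K) L"
    then show ?thesis by (auto simp: lquot_def lconc_def) (metis append.assoc)
  next
    assume "t \<in> \<Union> {lquot s L | s. \<exists>p\<in>K. w = p @ s}"
    then show ?thesis by (auto simp: lquot_def lconc_def) blast
  qed
qed

lemma recognizable_lconc:
  assumes "recognizable K" "recognizable L"
  shows "recognizable (lconc K L)"
proof (rule recognizableI)
  let ?F = "(\<lambda>(X, Y). lconc X L \<union> \<Union> Y) ` (range (\<lambda>w. lquot w K) \<times> Pow (range (\<lambda>w. lquot w L)))"
  show "finite ?F" using assms by (simp add: recognizable_def)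
  show "lquot w (lconc K L) \<in> ?F" for w
    unfolding lquot_lconc by (rule image_eqI[of _ _ "(lquot w K, _)"]) auto
qed

lemma recognizable_range_replicate: "recognizable (range (\<lambda>j. replicate j b))"
proof -
  have "w \<in> range (\<lambda>j. replicate j b)" if "w \<in> lists {b}" for w
    using that replicate_length_same[of w b] by (metis in_listsD rangeI singletonD)
  then have "range (\<lambda>j. replicate j b) = lists {b}" by auto
  then show ?thesis by (simp only: recognizable_lists)
qed

definition eventually_pumped :: "(nat \<Rightarrow> 'a list) \<Rightarrow> bool" where
  "eventually_pumped f \<longleftrightarrow> (\<exists>N P b Q. \<forall>j. f (N + j) = P @ replicate j b @ Q)"

lemma recognizable_range_if_pumped:
  assumes "eventually_pumped f"
  shows "recognizable (range f)"
proof -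
  obtain N P b Q where f: "\<And>j. f (N + j) = P @ replicate j b @ Q"
    using assms unfolding eventually_pumped_def by blast
  have "range (\<lambda>j. f (N + j)) = lconc {P} (lconc (range (\<lambda>j. replicate j b)) {Q})"
    by (auto simp: f lconc_def)
  moreover have "m < N \<or> (\<exists>j. m = N + j)" for m by presburger
  then have "range f = f ` {..<N} \<union> range (\<lambda>j. f (N + j))" by (auto simp: image_iff)
  ultimately show ?thesis
    by (simp add: recognizable_Un recognizable_finite recognizable_lconc recognizable_singleton
        recognizable_range_replicate)
qed

section \<open>Automatic relations\<close>

definition conv_lang :: "('a list \<times> 'a list) set \<Rightarrow> ('a option \<times> 'a option) list set" where
  "conv_lang R = {pad \<alpha> \<beta> | \<alpha> \<beta>. (\<alpha>, \<beta>) \<in> R}"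

definition automatic_rel :: "('a list \<times> 'a list) set \<Rightarrow> bool" where
  "automatic_rel R \<longleftrightarrow> recognizable (conv_lang R)"

lemma map_filter_append:
  "List.map_filter f (v @ w) = List.map_filter f v @ List.map_filter f w"
  by (simp add: List.map_filter_def)

lemma map_filter_fst_pad: "List.map_filter fst (pad \<alpha> \<beta>) = \<alpha>"
  by (induction \<alpha> \<beta> rule: pad.induct) auto

lemma map_filter_snd_pad: "List.map_filter snd (pad \<alpha> \<beta>) = \<beta>"
  by (induction \<alpha> \<beta> rule: pad.induct) auto

lemma pad_inject: "pad \<alpha> \<beta> = pad \<alpha>' \<beta>' \<longleftrightarrow> \<alpha> = \<alpha>' \<and> \<beta> = \<beta>'"
  by (metis map_filter_fst_pad map_filter_snd_pad)

lemma pad_append: "length \<alpha> = length \<alpha>' \<Longrightarrow> pad (\<alpha> @ \<beta>) (\<alpha>' @ \<beta>') = pad \<alpha> \<alpha>' @ pad \<beta> \<beta>'"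
  by (induction \<alpha> \<alpha>' rule: list_induct2) auto

lemma pad_same: "pad \<delta> \<delta> = map (\<lambda>a. (Some a, Some a)) \<delta>"
  by (induction \<delta>) auto

lemma pad_Nil_right: "pad \<alpha> [] = map (\<lambda>a. (Some a, None)) \<alpha>"
  by (induction \<alpha>) auto

lemma pad_Nil_left: "pad [] \<beta> = map (\<lambda>b. (None, Some b)) \<beta>"
  by (induction \<beta>) auto

lemma pad_eq_map_zip:
  "length \<alpha> = length \<beta> \<Longrightarrow> pad \<alpha> \<beta> = map (\<lambda>(a, b). (Some a, Some b)) (zip \<alpha> \<beta>)"
  by (induction \<alpha> \<beta> rule: list_induct2) auto

lemma pad_replicate: "pad (replicate j b) (replicate j d) = replicate j (Some b, Some d)"
  by (induction j) auto

lemma conv_lang_Int: "conv_lang (R \<inter> R') = conv_lang R \<inter> conv_lang R'"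
  by (auto simp: conv_lang_def pad_inject)

lemma automatic_rel_Int: "automatic_rel R \<Longrightarrow> automatic_rel R' \<Longrightarrow> automatic_rel (R \<inter> R')"
  by (simp add: automatic_rel_def conv_lang_Int recognizable_Int)

lemma automatic_rel_UNION:
  assumes "finite I" and "\<And>i. i \<in> I \<Longrightarrow> automatic_rel (R i)"
  shows "automatic_rel (\<Union>i\<in>I. R i)"
proof -
  have "conv_lang (\<Union>i\<in>I. R i) = (\<Union>i\<in>I. conv_lang (R i))" by (auto simp: conv_lang_def)
  then show ?thesis using assms by (simp add: automatic_rel_def recognizable_UNION)
qed

lemma automatic_rel_Un: "automatic_rel R \<Longrightarrow> automatic_rel R' \<Longrightarrow> automatic_rel (R \<union> R')"
  using automatic_rel_UNION[of UNIV "\<lambda>b. if b then R else R'"] by (simp add: UNIV_bool Un_commute)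

lemma automatic_rel_finite: "finite R \<Longrightarrow> automatic_rel R"
proof -
  assume "finite R"
  moreover have "conv_lang R = case_prod pad ` R" by (auto simp: conv_lang_def)
  ultimately show ?thesis by (simp add: automatic_rel_def recognizable_finite)
qed

lemma conv_lang_UNIV:
  "conv_lang UNIV = lconc (range (map (\<lambda>(a, b). (Some a, Some b))))
    (range (map (\<lambda>a. (Some a, None))) \<union> range (map (\<lambda>b. (None, Some b))))" (is "?lhs = ?rhs")
proof (intro equalityI subsetI)
  fix w assume "w \<in> ?lhs"
  then obtain \<alpha> \<beta> where w: "w = pad \<alpha> \<beta>" by (auto simp: conv_lang_def)
  define n where "n = min (length \<alpha>) (length \<beta>)"
  have "w = pad (take n \<alpha>) (take n \<beta>) @ pad (drop n \<alpha>) (drop n \<beta>)"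
    using pad_append[of "take n \<alpha>" "take n \<beta>" "drop n \<alpha>" "drop n \<beta>"] by (simp add: w n_def)
  moreover have "pad (take n \<alpha>) (take n \<beta>)
      = map (\<lambda>(a, b). (Some a, Some b)) (zip (take n \<alpha>) (take n \<beta>))"
    by (rule pad_eq_map_zip) (simp add: n_def)
  moreover have "drop n \<alpha> = [] \<or> drop n \<beta> = []" by (auto simp: n_def)
  then have "pad (drop n \<alpha>) (drop n \<beta>)
      \<in> range (map (\<lambda>a. (Some a, None))) \<union> range (map (\<lambda>b. (None, Some b)))"
    by (metis UnCI pad_Nil_left pad_Nil_right rangeI)
  ultimately show "w \<in> ?rhs" unfolding lconc_def by blast
next
  fix w assume "w \<in> ?rhs"
  then obtain z \<alpha> \<beta> where "w = map (\<lambda>(a, b). (Some a, Some b)) z @ pad \<alpha> \<beta>"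
    by (auto simp: lconc_def) (metis pad_Nil_left pad_Nil_right)+
  then have "w = pad (map fst z @ \<alpha>) (map snd z @ \<beta>)"
    using pad_eq_map_zip[of "map fst z" "map snd z"] by (simp add: pad_append zip_map_fst_snd)
  then show "w \<in> ?lhs" by (auto simp: conv_lang_def)
qed

lemma automatic_rel_UNIV: "automatic_rel UNIV"
  unfolding automatic_rel_def conv_lang_UNIV
  by (intro recognizable_lconc recognizable_Un recognizable_map_image recognizable_UNIV)

lemma automatic_rel_Times:
  assumes "recognizable K" "recognizable L"
  shows "automatic_rel (K \<times> L)"
proof -
  have "conv_lang (K \<times> L) = conv_lang UNIV \<inter> {w. List.map_filter fst w \<in> K}
      \<inter> {w. List.map_filter snd w \<in> L}"
    by (auto simp: conv_lang_def map_filter_fst_pad map_filter_snd_pad) metis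
  then show ?thesis
    using assms
    by (simp add: automatic_rel_def automatic_rel_UNIV[unfolded automatic_rel_def]
        recognizable_Int recognizable_vimage_hom map_filter_append)
qed

lemma automatic_rel_Id: "automatic_rel (Id :: ('a list \<times> 'a list) set)"
proof -
  have "conv_lang (Id :: ('a list \<times> 'a list) set) = range (map (\<lambda>a. (Some a, Some a)))"
    by (auto simp: conv_lang_def pad_same)
  then show ?thesis by (simp add: automatic_rel_def recognizable_map_image recognizable_UNIV)
qed

definition common_prefix_closure :: "('a list \<times> 'a list) set \<Rightarrow> ('a list \<times> 'a list) set" where
  "common_prefix_closure T = {(\<delta> @ s, \<delta> @ t) | \<delta> s t. (s, t) \<in> T}"

lemma automatic_rel_common_prefix_closure:
  assumes "automatic_rel T"
  shows "automatic_rel (common_prefix_closure T)"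
proof -
  have "conv_lang (common_prefix_closure T) = lconc (conv_lang Id) (conv_lang T)"
    unfolding conv_lang_def lconc_def common_prefix_closure_def
    by auto (metis pad_append, metis pad_append)
  then show ?thesis
    using assms
    by (simp add: automatic_rel_def automatic_rel_Id[unfolded automatic_rel_def] recognizable_lconc)
qed

subsection \<open>Composition\<close>

definition opt_pad :: "nat \<Rightarrow> 'a list \<Rightarrow> 'a option list" where
  "opt_pad N w = map Some w @ replicate (N - length w) None"

abbreviation blanks :: "('a option \<times> 'a option) list set" where
  "blanks \<equiv> range (\<lambda>j. replicate j (None, None))"

definition padded_conv_lang :: "('a list \<times> 'a list) set \<Rightarrow> ('a option \<times> 'a option) list set" where
  "padded_conv_lang R = {zip (opt_pad N \<alpha>) (opt_pad N \<beta>) | N \<alpha> \<beta>.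
     (\<alpha>, \<beta>) \<in> R \<and> length \<alpha> \<le> N \<and> length \<beta> \<le> N}"

lemma length_opt_pad: "length w \<le> N \<Longrightarrow> length (opt_pad N w) = N"
  by (simp add: opt_pad_def)

lemma opt_pad_Suc [simp]:
  "opt_pad (Suc N) [] = None # opt_pad N []" "opt_pad (Suc N) (a # w) = Some a # opt_pad N w"
  by (simp_all add: opt_pad_def)

lemma opt_pad_inject: "opt_pad N v = opt_pad N w \<longleftrightarrow> v = w"
proof -
  have "List.map_filter (\<lambda>a. a) (opt_pad N w) = w" for w :: "'a list"
    by (induction w) (simp_all add: opt_pad_def List.map_filter_def)
  then show ?thesis by metis
qed

lemma zip_opt_pad:
  "length \<alpha> \<le> N \<Longrightarrow> length \<beta> \<le> N \<Longrightarrow> zip (opt_pad N \<alpha>) (opt_pad N \<beta>)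
    = pad \<alpha> \<beta> @ replicate (N - max (length \<alpha>) (length \<beta>)) (None, None)"
proof (induction \<alpha> \<beta> arbitrary: N rule: pad.induct)
  case 1
  show ?case by (simp add: opt_pad_def)
next
  case (2 a as)
  then show ?case by (cases N) auto
next
  case (3 b bs)
  then show ?case by (cases N) auto
next
  case (4 a as b bs)
  then show ?case by (cases N) auto
qed

lemma padded_conv_lang_eq_lconc: "padded_conv_lang R = lconc (conv_lang R) blanks"
proof (intro equalityI subsetI)
  fix w assume "w \<in> padded_conv_lang R"
  then show "w \<in> lconc (conv_lang R) blanks"
    unfolding padded_conv_lang_def lconc_def conv_lang_def
    by (auto simp: zip_opt_pad) (metis rangeI)
next
  fix w assume "w \<in> lconc (conv_lang R) blanks"
  then obtain \<alpha> \<beta> j where "(\<alpha>, \<beta>) \<in> R" "w = pad \<alpha> \<beta> @ replicate j (None, None)"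
    by (auto simp: lconc_def conv_lang_def)
  moreover from this have "w = zip (opt_pad (max (length \<alpha>) (length \<beta>) + j) \<alpha>)
      (opt_pad (max (length \<alpha>) (length \<beta>) + j) \<beta>)"
    by (simp add: zip_opt_pad)
  ultimately show "w \<in> padded_conv_lang R"
    unfolding padded_conv_lang_def by fastforce
qed

lemma pad_blanks_inject:
  "pad \<alpha> \<beta> @ replicate i (None, None) = pad \<alpha>' \<beta>' @ replicate j (None, None)
    \<Longrightarrow> \<alpha> = \<alpha>' \<and> \<beta> = \<beta>'"
proof -
  have blank: "List.map_filter f (replicate i (None, None)) = []"
    if "f (None, None) = None" for f :: "'a option \<times> 'a option \<Rightarrow> 'a option" and i
    using that by (induction i) simp_all
  assume "pad \<alpha> \<beta> @ replicate i (None, None) = pad \<alpha>' \<beta>' @ replicate j (None, None)"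
  from arg_cong[OF this, of "List.map_filter fst"] arg_cong[OF this, of "List.map_filter snd"]
  show ?thesis by (simp add: map_filter_append blank map_filter_fst_pad map_filter_snd_pad)
qed

lemma map_map_prod_id_zip: "map (map_prod id f) (zip xs ys) = zip xs (map f ys)"
  by (simp add: zip_map2 map_prod_def)

definition three_tape_lang :: "('a list \<times> 'a list) set \<Rightarrow> ('a list \<times> 'a list) set
    \<Rightarrow> ('a option \<times> 'a option \<times> 'a option) list set" where
  "three_tape_lang R R' =
     {t. map (map_prod id fst) t \<in> padded_conv_lang R} \<inter> {t. map snd t \<in> padded_conv_lang R'}"

lemma three_tape_lang_iff:
  "t \<in> three_tape_lang R R'
    \<longleftrightarrow> (\<exists>N \<alpha> \<beta> \<gamma>. t = zip (opt_pad N \<alpha>) (zip (opt_pad N \<beta>) (opt_pad N \<gamma>)) \<and>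
      (\<alpha>, \<beta>) \<in> R \<and> (\<beta>, \<gamma>) \<in> R' \<and> length \<alpha> \<le> N \<and> length \<beta> \<le> N \<and> length \<gamma> \<le> N)"
    (is "?lhs \<longleftrightarrow> ?rhs")
proof
  assume ?lhs
  then obtain N \<alpha> \<beta> N' \<beta>' \<gamma> where
    left: "map (map_prod id fst) t = zip (opt_pad N \<alpha>) (opt_pad N \<beta>)"
      "(\<alpha>, \<beta>) \<in> R" "length \<alpha> \<le> N" "length \<beta> \<le> N" and
    right: "map snd t = zip (opt_pad N' \<beta>') (opt_pad N' \<gamma>)"
      "(\<beta>', \<gamma>) \<in> R'" "length \<beta>' \<le> N'" "length \<gamma> \<le> N'"
    unfolding three_tape_lang_def padded_conv_lang_def by blast
  have "N' = N"
    using arg_cong[OF left(1), of length] arg_cong[OF right(1), of length] left(3,4) right(3,4)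
    by (simp add: length_opt_pad)
  have tapes: "map fst t = opt_pad N \<alpha>" "map (fst \<circ> snd) t = opt_pad N \<beta>"
      "map (fst \<circ> snd) t = opt_pad N \<beta>'" "map (snd \<circ> snd) t = opt_pad N \<gamma>"
    using arg_cong[OF left(1), of "map fst"] arg_cong[OF left(1), of "map snd"]
      arg_cong[OF right(1), of "map fst"] arg_cong[OF right(1), of "map snd"] left(3,4) right(3,4)
    by (simp_all add: length_opt_pad \<open>N' = N\<close> comp_def case_prod_unfold)
  have "\<beta> = \<beta>'" using tapes(2,3) opt_pad_inject by metis
  have "t = zip (map fst t) (zip (map (fst \<circ> snd) t) (map (snd \<circ> snd) t))"
    by (induction t) auto
  then have "t = zip (opt_pad N \<alpha>) (zip (opt_pad N \<beta>) (opt_pad N \<gamma>))"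
    unfolding tapes(1,2,4) .
  then show ?rhs using left(2-4) right(2-4) \<open>N' = N\<close> \<open>\<beta> = \<beta>'\<close> by blast
next
  assume ?rhs
  then show ?lhs
    by (fastforce simp: three_tape_lang_def padded_conv_lang_def map_map_prod_id_zip length_opt_pad)
qed

text \<open>Erasing the middle tape can leave trailing blank pairs, which the right quotient cuts off.\<close>

lemma conv_lang_relcomp:
  "conv_lang (R O R') =
    conv_lang UNIV \<inter> {w. \<exists>s\<in>blanks. w @ s \<in> map (map_prod id snd) ` three_tape_lang R R'}"
    (is "?lhs = ?rhs")
proof (intro equalityI subsetI)
  fix w assume "w \<in> ?lhs"
  then obtain \<alpha> \<beta> \<gamma> where w: "w = pad \<alpha> \<gamma>" "(\<alpha>, \<beta>) \<in> R" "(\<beta>, \<gamma>) \<in> R'"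
    by (auto simp: conv_lang_def)
  define N where "N = length \<alpha> + length \<beta> + length \<gamma>"
  let ?t = "zip (opt_pad N \<alpha>) (zip (opt_pad N \<beta>) (opt_pad N \<gamma>))"
  have len: "length \<alpha> \<le> N" "length \<beta> \<le> N" "length \<gamma> \<le> N" by (simp_all add: N_def)
  then have "?t \<in> three_tape_lang R R'" unfolding three_tape_lang_iff using w(2,3) by blast
  moreover have "map (map_prod id snd) ?t = zip (opt_pad N \<alpha>) (opt_pad N \<gamma>)"
    using len by (simp add: map_map_prod_id_zip length_opt_pad)
  then have "w @ replicate (N - max (length \<alpha>) (length \<gamma>)) (None, None) = map (map_prod id snd) ?t"
    using len by (simp add: zip_opt_pad w(1))
  moreover have "w \<in> conv_lang UNIV" by (auto simp: conv_lang_def w(1))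
  ultimately show "w \<in> ?rhs" by blast
next
  fix w assume "w \<in> ?rhs"
  then obtain \<alpha>' \<gamma>' j t where w: "w = pad \<alpha>' \<gamma>'" and t: "t \<in> three_tape_lang R R'"
      "w @ replicate j (None, None) = map (map_prod id snd) t"
    by (auto simp: conv_lang_def)
  from t(1) obtain N \<alpha> \<beta> \<gamma> where
    tapes: "t = zip (opt_pad N \<alpha>) (zip (opt_pad N \<beta>) (opt_pad N \<gamma>))" and
    comp: "(\<alpha>, \<beta>) \<in> R" "(\<beta>, \<gamma>) \<in> R'" "length \<alpha> \<le> N" "length \<beta> \<le> N" "length \<gamma> \<le> N"
    unfolding three_tape_lang_iff by blast
  have "pad \<alpha>' \<gamma>' @ replicate j (None, None) = zip (opt_pad N \<alpha>) (opt_pad N \<gamma>)"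
    using t(2) comp by (simp add: w tapes map_map_prod_id_zip length_opt_pad)
  then have "pad \<alpha>' \<gamma>' @ replicate j (None, None)
      = pad \<alpha> \<gamma> @ replicate (N - max (length \<alpha>) (length \<gamma>)) (None, None)"
    using comp by (simp only: zip_opt_pad)
  then have "\<alpha>' = \<alpha>" "\<gamma>' = \<gamma>" using pad_blanks_inject by blast+
  then show "w \<in> ?lhs" using w comp by (auto simp: conv_lang_def)
qed

lemma automatic_rel_relcomp:
  assumes "automatic_rel R" "automatic_rel R'"
  shows "automatic_rel (R O R')"
proof -
  have "recognizable (three_tape_lang R R')"
    using assms unfolding automatic_rel_def three_tape_lang_def padded_conv_lang_eq_lconc
    by (intro recognizable_Int recognizable_vimage_hom recognizable_lconc
        recognizable_range_replicate) auto
  then show ?thesis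
    using automatic_rel_UNIV unfolding automatic_rel_def conv_lang_relcomp
    by (intro recognizable_Int recognizable_rquot recognizable_map_image)
qed

subsection \<open>Pumping\<close>

lemma eventually_pumped_pad:
  assumes "eventually_pumped f" "eventually_pumped g"
  shows "eventually_pumped (\<lambda>m. pad (f m) (g m))"
proof -
  obtain M P b Q where f: "\<And>j. f (M + j) = P @ replicate j b @ Q"
    using assms(1) unfolding eventually_pumped_def by blast
  obtain N P' d Q' where g: "\<And>j. g (N + j) = P' @ replicate j d @ Q'"
    using assms(2) unfolding eventually_pumped_def by blast
  let ?X = "P @ replicate (length P') b" and ?X' = "P' @ replicate (length P) d"
  let ?Y = "replicate (N + length P) b @ Q" and ?Y' = "replicate (M + length P') d @ Q'"
  let ?K = "M + N + length P + length P'"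
  have "pad (f (?K + j)) (g (?K + j))
      = pad ?X ?X' @ replicate j (Some b, Some d) @ pad ?Y ?Y'" for j
  proof -
    have "f (?K + j) = f (M + (length P' + (j + (N + length P))))" by (simp add: algebra_simps)
    also have "\<dots> = ?X @ replicate j b @ ?Y" by (simp only: f replicate_add append_assoc)
    finally have fK: "f (?K + j) = ?X @ replicate j b @ ?Y" .
    have "g (?K + j) = g (N + (length P + (j + (M + length P'))))" by (simp add: algebra_simps)
    also have "\<dots> = ?X' @ replicate j d @ ?Y'" by (simp only: g replicate_add append_assoc)
    finally show ?thesis
      unfolding fK
      by (simp only: pad_append pad_replicate length_append length_replicate add.commute)
  qed
  then show ?thesis unfolding eventually_pumped_def by blast
qed

lemma automatic_rel_if_pumped:
  assumes "eventually_pumped f" "eventually_pumped g"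
  shows "automatic_rel (range (\<lambda>m. (f m, g m)))"
proof -
  have "conv_lang (range (\<lambda>m. (f m, g m))) = range (\<lambda>m. pad (f m) (g m))"
    by (auto simp: conv_lang_def)
  then show ?thesis
    using assms by (simp add: automatic_rel_def recognizable_range_if_pumped eventually_pumped_pad)
qed

section \<open>Automatic structures from coded words\<close>

lemma congr_gen_context:
  assumes "(v, w) \<in> congr_gen R"
  shows "(l @ v @ r, l @ w @ r) \<in> congr_gen R"
  using assms
proof induction
  case (base u v p q)
  then show ?case using congr_gen.base[of u v R "l @ p" "q @ r"] by simp
qed (auto intro: congr_gen.intros)

lemma congr_gen_append_left: "(v, w) \<in> congr_gen R \<Longrightarrow> (l @ v, l @ w) \<in> congr_gen R"
  using congr_gen_context[of v w R l "[]"] by simp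

lemma congr_gen_append_right: "(v, w) \<in> congr_gen R \<Longrightarrow> (v @ r, w @ r) \<in> congr_gen R"
  using congr_gen_context[of v w R "[]" r] by simp

lemma congr_gen_append:
  "(v, v') \<in> congr_gen R \<Longrightarrow> (w, w') \<in> congr_gen R \<Longrightarrow> (v @ w, v' @ w') \<in> congr_gen R"
  by (rule congr_gen.trans[OF congr_gen_append_right congr_gen_append_left])

lemma congr_gen_rule: "(v, w) \<in> R \<Longrightarrow> (v, w) \<in> congr_gen R"
  using congr_gen.base[of v w R "[]" "[]"] by simp

lemma congr_gen_subsetI:
  assumes "R \<subseteq> congr_gen R'"
  shows "congr_gen R \<subseteq> congr_gen R'"
proof
  fix p assume "p \<in> congr_gen R"
  moreover have "(v, w) \<in> congr_gen R'" if "(v, w) \<in> congr_gen R" for v w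
    using that by induction (use assms in \<open>auto intro: congr_gen.intros congr_gen_context\<close>)
  ultimately show "p \<in> congr_gen R'" by (cases p) simp
qed

lemma congr_gen_in_lists_iff:
  assumes "R \<subseteq> lists A \<times> lists A" and "(v, w) \<in> congr_gen R"
  shows "v \<in> lists A \<longleftrightarrow> w \<in> lists A"
  using assms(2) by induction (use assms(1) in auto)

lemma congr_gen_Nil_iff:
  assumes "R \<subseteq> (- {[]}) \<times> (- {[]})" and "(v, w) \<in> congr_gen R"
  shows "v = [] \<longleftrightarrow> w = []"
  using assms(2) by induction (use assms(1) in auto)

lemma cls_eq_iff:
  assumes "v \<in> lists A" "w \<in> lists A"
  shows "cls A R v = cls A R w \<longleftrightarrow> (v, w) \<in> congr_gen R"
proof
  assume "cls A R v = cls A R w"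
  moreover have "w \<in> cls A R w" using assms(2) by (simp add: cls_def congr_gen.refl)
  ultimately have "w \<in> cls A R v" by simp
  then show "(v, w) \<in> congr_gen R" by (simp add: cls_def)
next
  assume "(v, w) \<in> congr_gen R"
  then show "cls A R v = cls A R w"
    unfolding cls_def by (blast intro: congr_gen.trans congr_gen.sym)
qed

lemma sgp_mult_cls:
  assumes "v \<in> lists A" "w \<in> lists A"
  shows "sgp_mult A R (cls A R v) (cls A R w) = cls A R (v @ w)"
proof -
  have representative: "(SOME z. z \<in> cls A R v) \<in> cls A R v" if "v \<in> lists A" for v
    by (rule someI[of _ v]) (simp add: cls_def congr_gen.refl that[simplified])
  let ?v = "SOME z. z \<in> cls A R v" and ?w = "SOME z. z \<in> cls A R w"
  have "?v \<in> lists A" "(v, ?v) \<in> congr_gen R" "?w \<in> lists A" "(w, ?w) \<in> congr_gen R"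
    using representative[OF assms(1)] representative[OF assms(2)] by (simp_all add: cls_def)
  then have "(?v @ ?w, v @ w) \<in> congr_gen R" "?v @ ?w \<in> lists A"
    by (auto intro: congr_gen_append congr_gen.sym)
  then show ?thesis unfolding sgp_mult_def using assms by (subst cls_eq_iff) auto
qed

lemma concat_in_lists: "\<alpha> \<in> lists B \<Longrightarrow> B \<subseteq> lists A \<Longrightarrow> concat \<alpha> \<in> lists A"
  by (induction \<alpha>) auto

lemma ev_map_cls:
  assumes "B \<subseteq> lists A" "\<alpha> \<in> lists B" "\<alpha> \<noteq> []"
  shows "ev (sgp_mult A R) (map (cls A R) \<alpha>) = cls A R (concat \<alpha>)"
  using assms(2,3)
proof (induction \<alpha> rule: induct_list012)
  case (3 b c \<alpha>)
  then have "b \<in> lists A" "concat (c # \<alpha>) \<in> lists A"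
    using assms(1) concat_in_lists[of "c # \<alpha>" B A] by auto
  then show ?case using 3 sgp_mult_cls[of b A "concat (c # \<alpha>)" R] by simp
qed auto

lemma pad_map:
  "pad (map f \<alpha>) (map f \<beta>) = map (map_prod (map_option f) (map_option f)) (pad \<alpha> \<beta>)"
  by (induction \<alpha> \<beta> rule: pad.induct) auto

lemma conv_lang_map_image:
  "conv_lang (map_prod (map f) (map f) ` R)
    = map (map_prod (map_option f) (map_option f)) ` conv_lang R"
  unfolding conv_lang_def by (force simp: pad_map image_iff)

lemma pad_in_pair_alph:
  "\<alpha> \<in> lists A \<Longrightarrow> \<beta> \<in> lists A \<Longrightarrow> pad \<alpha> \<beta> \<in> lists (pair_alph A)"
  by (induction \<alpha> \<beta> rule: pad.induct) (auto simp: pair_alph_def)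

lemma regular_conv_lang_map_image:
  assumes "automatic_rel R" "R \<subseteq> lists B \<times> lists B"
  shows "regular (pair_alph (f ` B)) (conv_lang (map_prod (map f) (map f) ` R))"
proof (rule regular_if_recognizable)
  show "recognizable (conv_lang (map_prod (map f) (map f) ` R))"
    unfolding conv_lang_map_image using assms(1)
    by (simp add: automatic_rel_def recognizable_map_image)
  show "conv_lang (map_prod (map f) (map f) ` R) \<subseteq> lists (pair_alph (f ` B))"
  proof
    fix w assume "w \<in> conv_lang (map_prod (map f) (map f) ` R)"
    then obtain \<alpha> \<beta> where "(\<alpha>, \<beta>) \<in> R" "w = pad (map f \<alpha>) (map f \<beta>)"
      by (auto simp: conv_lang_def)
    moreover from this have "map f \<alpha> \<in> lists (f ` B)" "map f \<beta> \<in> lists (f ` B)"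
      using assms(2) by (auto simp: lists_image)
    ultimately show "w \<in> lists (pair_alph (f ` B))" by (simp only: pad_in_pair_alph)
  qed
qed

definition right_mult_rel :: "('a list \<times> 'a list) set \<Rightarrow> 'a list list set \<Rightarrow> 'a list
    \<Rightarrow> ('a list list \<times> 'a list list) set" where
  "right_mult_rel R L w =
     {(\<alpha>, \<beta>). \<alpha> \<in> L \<and> \<beta> \<in> L \<and> (concat \<alpha> @ w, concat \<beta>) \<in> congr_gen R}"

locale word_coding =
  fixes A :: "'a set" and R :: "('a list \<times> 'a list) set" and B :: "'a list set"
    and L :: "'a list list set"
  assumes finite_blocks: "finite B" and blocks_subset: "B \<subseteq> lists A - {[]}"
    and codes_subset: "L \<subseteq> lists B - {[]}" and recognizable_codes: "recognizable L"
    and represented: "\<And>w. w \<in> lists A \<Longrightarrow> w \<noteq> [] \<Longrightarrow> \<exists>\<alpha>\<in>L. (w, concat \<alpha>) \<in> congr_gen R"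
    and automatic_rel_equal: "automatic_rel (right_mult_rel R L [])"
    and automatic_rel_mult_letter: "\<And>a. a \<in> A \<Longrightarrow> automatic_rel (right_mult_rel R L [a])"
begin

lemma concat_code_in_lists: "\<alpha> \<in> L \<Longrightarrow> concat \<alpha> \<in> lists A"
  using codes_subset blocks_subset by (intro concat_in_lists[of \<alpha> B A]) auto

lemma concat_code_nonempty:
  assumes "\<alpha> \<in> L" shows "concat \<alpha> \<noteq> []"
proof -
  have "\<alpha> \<in> lists B" "\<alpha> \<noteq> []" using assms codes_subset by auto
  then show ?thesis using blocks_subset by (cases \<alpha>) auto
qed

lemma right_mult_rel_append:
  assumes "v \<in> lists A"
  shows "right_mult_rel R L (v @ w) = right_mult_rel R L v O right_mult_rel R L w"
proof (intro equalityI subrelI)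
  fix \<alpha> \<beta> assume \<alpha>\<beta>: "(\<alpha>, \<beta>) \<in> right_mult_rel R L (v @ w)"
  then have "concat \<alpha> @ v \<in> lists A" "concat \<alpha> @ v \<noteq> []"
    using assms concat_code_in_lists concat_code_nonempty by (auto simp: right_mult_rel_def)
  from represented[OF this] obtain \<gamma> where \<gamma>: "\<gamma> \<in> L" "(concat \<alpha> @ v, concat \<gamma>) \<in> congr_gen R"
    by blast
  have "(concat \<gamma> @ w, concat \<alpha> @ v @ w) \<in> congr_gen R"
    using congr_gen.sym[OF congr_gen_append_right[OF \<gamma>(2), of w]] by simp
  then have "(concat \<gamma> @ w, concat \<beta>) \<in> congr_gen R"
    using \<alpha>\<beta> by (auto simp: right_mult_rel_def intro: congr_gen.trans)
  then show "(\<alpha>, \<beta>) \<in> right_mult_rel R L v O right_mult_rel R L w"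
    using \<alpha>\<beta> \<gamma> by (auto simp: right_mult_rel_def)
next
  fix \<alpha> \<beta> assume "(\<alpha>, \<beta>) \<in> right_mult_rel R L v O right_mult_rel R L w"
  then obtain \<gamma> where \<gamma>: "\<alpha> \<in> L" "\<beta> \<in> L" "(concat \<alpha> @ v, concat \<gamma>) \<in> congr_gen R"
      "(concat \<gamma> @ w, concat \<beta>) \<in> congr_gen R"
    by (auto simp: right_mult_rel_def)
  have "(concat \<alpha> @ v @ w, concat \<gamma> @ w) \<in> congr_gen R"
    using congr_gen_append_right[OF \<gamma>(3), of w] by simp
  then have "(concat \<alpha> @ v @ w, concat \<beta>) \<in> congr_gen R" using \<gamma>(4) by (rule congr_gen.trans)
  then show "(\<alpha>, \<beta>) \<in> right_mult_rel R L (v @ w)" using \<gamma> by (simp add: right_mult_rel_def)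
qed

lemma automatic_rel_right_mult: "w \<in> lists A \<Longrightarrow> automatic_rel (right_mult_rel R L w)"
proof (induction w rule: rev_induct)
  case Nil
  show ?case by (rule automatic_rel_equal)
next
  case (snoc a w)
  then show ?case
    using automatic_rel_mult_letter by (simp add: right_mult_rel_append automatic_rel_relcomp)
qed

abbreviation mult :: "'a list set \<Rightarrow> 'a list set \<Rightarrow> 'a list set" where
  "mult \<equiv> sgp_mult A R"

abbreviation generators :: "'a list set set" where
  "generators \<equiv> cls A R ` B"

abbreviation representatives :: "'a list set list set" where
  "representatives \<equiv> map (cls A R) ` L"

lemma ev_code: "\<alpha> \<in> L \<Longrightarrow> ev mult (map (cls A R) \<alpha>) = cls A R (concat \<alpha>)"
  using blocks_subset codes_subset by (intro ev_map_cls[of B]) auto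

lemma ev_representatives: "ev mult ` representatives = sgp_carrier A R"
proof (intro equalityI subsetI)
  fix X assume "X \<in> ev mult ` representatives"
  then show "X \<in> sgp_carrier A R"
    using concat_code_in_lists concat_code_nonempty by (auto simp: ev_code sgp_carrier_def)
next
  fix X assume "X \<in> sgp_carrier A R"
  then obtain w where w: "w \<in> lists A" "w \<noteq> []" "X = cls A R w" by (auto simp: sgp_carrier_def)
  from represented[OF w(1,2)] obtain \<alpha> where \<alpha>: "\<alpha> \<in> L" "(w, concat \<alpha>) \<in> congr_gen R" by blast
  then have "X = ev mult (map (cls A R) \<alpha>)"
    using w(3) cls_eq_iff[OF w(1) concat_code_in_lists] by (simp add: ev_code)
  with \<alpha>(1) show "X \<in> ev mult ` representatives" by blast
qed

lemma ev_code_append_eq_iff: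
  assumes "\<alpha> \<in> L" "\<beta> \<in> L" "\<gamma> \<in> lists B"
  shows "ev mult (map (cls A R) \<alpha> @ map (cls A R) \<gamma>) = ev mult (map (cls A R) \<beta>)
    \<longleftrightarrow> (concat \<alpha> @ concat \<gamma>, concat \<beta>) \<in> congr_gen R"
proof -
  have \<alpha>\<gamma>: "\<alpha> @ \<gamma> \<in> lists B" "\<alpha> @ \<gamma> \<noteq> []" and B: "B \<subseteq> lists A"
    using assms codes_subset blocks_subset by auto
  have "ev mult (map (cls A R) (\<alpha> @ \<gamma>)) = cls A R (concat (\<alpha> @ \<gamma>))"
    using B \<alpha>\<gamma> by (rule ev_map_cls)
  moreover have "concat (\<alpha> @ \<gamma>) \<in> lists A" using \<alpha>\<gamma>(1) B by (rule concat_in_lists)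
  ultimately show ?thesis
    using assms(2) concat_code_in_lists by (simp add: ev_code cls_eq_iff del: in_lists_conv_set)
qed

lemma regular_mult:
  assumes "\<gamma> \<in> lists B"
  shows "regular (pair_alph generators) {pad \<alpha> \<beta> | \<alpha> \<beta>. \<alpha> \<in> representatives \<and>
    \<beta> \<in> representatives \<and> ev mult (\<alpha> @ map (cls A R) \<gamma>) = ev mult \<beta>}"
proof -
  let ?M = "right_mult_rel R L (concat \<gamma>)"
  have "concat \<gamma> \<in> lists A" using assms blocks_subset by (intro concat_in_lists[of \<gamma> B]) auto
  moreover have "?M \<subseteq> lists B \<times> lists B"
    using codes_subset by (auto simp: right_mult_rel_def)
  ultimately have "regular (pair_alph generators)
      (conv_lang (map_prod (map (cls A R)) (map (cls A R)) ` ?M))"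
    by (intro regular_conv_lang_map_image automatic_rel_right_mult)
  also have "map_prod (map (cls A R)) (map (cls A R)) ` ?M = {(\<alpha>, \<beta>). \<alpha> \<in> representatives \<and>
      \<beta> \<in> representatives \<and> ev mult (\<alpha> @ map (cls A R) \<gamma>) = ev mult \<beta>}"
    unfolding right_mult_rel_def using ev_code_append_eq_iff[OF _ _ assms] by fastforce
  finally show ?thesis by (simp add: conv_lang_def)
qed

lemma auto_structure_code: "auto_structure (sgp_carrier A R) mult generators representatives"
  unfolding auto_structure_def
proof (intro conjI ballI)
  show "finite generators" using finite_blocks by simp
  show "generators \<subseteq> sgp_carrier A R" using blocks_subset by (auto simp: sgp_carrier_def)
  show sub: "representatives \<subseteq> lists generators - {[]}"
    using codes_subset by (auto simp: lists_image)
  show "regular generators representatives"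
    using sub by (intro regular_if_recognizable recognizable_map_image recognizable_codes) auto
  show "ev mult ` representatives = sgp_carrier A R" by (rule ev_representatives)
  show "regular (pair_alph generators) {pad \<alpha> \<beta> | \<alpha> \<beta>. \<alpha> \<in> representatives \<and>
      \<beta> \<in> representatives \<and> ev mult \<alpha> = ev mult \<beta>}"
    using regular_mult[of "[]"] by simp
next
  fix X assume "X \<in> generators"
  then obtain b where "b \<in> B" "X = cls A R b" by blast
  then show "regular (pair_alph generators) {pad \<alpha> \<beta> | \<alpha> \<beta>. \<alpha> \<in> representatives \<and>
      \<beta> \<in> representatives \<and> ev mult (\<alpha> @ [X]) = ev mult \<beta>}"
    using regular_mult[of "[b]"] by simp
qed

lemma automatic: "automatic (sgp_carrier A R) mult"
  using auto_structure_code unfolding automatic_def by blast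

lemma prefix_automatic_if_prefix_closed:
  assumes "\<And>\<alpha> \<beta>. \<alpha> @ \<beta> \<in> L \<Longrightarrow> \<alpha> \<noteq> [] \<Longrightarrow> \<alpha> \<in> L"
  shows "prefix_automatic (sgp_carrier A R) mult"
proof -
  have Pref: "Pref representatives - {[]} = representatives"
  proof (intro equalityI subsetI)
    fix \<beta> assume "\<beta> \<in> Pref representatives - {[]}"
    then show "\<beta> \<in> representatives"
      using assms by (fastforce simp: Pref_def append_eq_map_conv)
  next
    fix \<beta> assume "\<beta> \<in> representatives"
    then show "\<beta> \<in> Pref representatives - {[]}"
      using codes_subset by (auto simp: Pref_def intro: exI[of _ "[]"])
  qed
  have "{pad \<alpha> \<beta> | \<alpha> \<beta>. \<alpha> \<in> representatives \<and> \<beta> \<in> Pref representatives \<and> \<beta> \<noteq> [] \<and>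
      ev mult \<alpha> = ev mult \<beta>} = {pad \<alpha> \<beta> | \<alpha> \<beta>. \<alpha> \<in> representatives \<and>
      \<beta> \<in> Pref representatives - {[]} \<and> ev mult \<alpha> = ev mult \<beta>}"
    by auto
  then have "regular (pair_alph generators) {pad \<alpha> \<beta> | \<alpha> \<beta>. \<alpha> \<in> representatives \<and>
      \<beta> \<in> Pref representatives \<and> \<beta> \<noteq> [] \<and> ev mult \<alpha> = ev mult \<beta>}"
    using regular_mult[of "[]"] unfolding Pref by simp
  then show ?thesis
    unfolding prefix_automatic_def using auto_structure_code by blast
qed

end

section \<open>Adjoining an identity\<close>

locale identity_adjunction = word_coding A R B L
  for A :: "nat set" and R B L +
  assumes zero_notin: "0 \<notin> A"
    and rules_subset: "R \<subseteq> (lists A - {[]}) \<times> (lists A - {[]})"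
begin

abbreviation strip :: "nat list \<Rightarrow> nat list" where
  "strip \<equiv> removeAll 0"

lemma strip_id: "w \<in> lists A \<Longrightarrow> strip w = w"
  using zero_notin by (auto intro: removeAll_id)

lemma strip_in_lists: "w \<in> lists (one_alph A) \<Longrightarrow> strip w \<in> lists A"
  by (auto simp: one_alph_def)

lemma lists_one_alph: "w \<in> lists A \<Longrightarrow> w \<in> lists (one_alph A)"
  by (auto simp: one_alph_def)

lemma congr_Nil_iff: "(v, w) \<in> congr_gen R \<Longrightarrow> v = [] \<longleftrightarrow> w = []"
  using rules_subset by (intro congr_gen_Nil_iff[of R]) auto

lemma strip_congr:
  assumes "(v, w) \<in> congr_gen (one_rels A R)"
  shows "(strip v, strip w) \<in> congr_gen R"
  using assms
proof induction
  case (base v w l r)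
  then consider "(v, w) \<in> R" | "strip v = strip w" by (auto simp: one_rels_def)
  then have "(strip v, strip w) \<in> congr_gen R"
  proof cases
    case 1
    then have "strip v = v" "strip w = w" using rules_subset by (auto intro!: strip_id)
    then show ?thesis using 1 by (simp add: congr_gen_rule)
  qed (simp add: congr_gen.refl)
  then show ?case using congr_gen_context by simp
qed (auto intro: congr_gen.intros)

definition strip1 :: "nat list \<Rightarrow> nat list" where
  "strip1 w = (if strip w = [] then [0] else strip w)"

lemma congr_strip1:
  assumes "w \<in> lists (one_alph A)" "w \<noteq> []"
  shows "(w, strip1 w) \<in> congr_gen (one_rels A R)"
  using assms
proof (induction w)
  case (Cons a w)
  show ?case
  proof (cases "w = []")
    case True
    then show ?thesis by (auto simp: strip1_def congr_gen.refl)
  next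
    case False
    then have IH: "(a # w, a # strip1 w) \<in> congr_gen (one_rels A R)"
      using Cons congr_gen_append_left[of w "strip1 w" _ "[a]"] by simp
    obtain b v where v: "strip1 w = b # v"
      by (cases "strip1 w") (auto simp: strip1_def split: if_splits)
    have "set (strip1 w) \<subseteq> insert 0 (set w)" by (auto simp: strip1_def)
    then have "b \<in> one_alph A" using Cons.hyps(2) v by (auto simp: one_alph_def)
    then have zero: "([0, b], [b]) \<in> one_rels A R" by (auto simp: one_alph_def one_rels_def)
    have "(a # strip1 w, strip1 (a # w)) \<in> congr_gen (one_rels A R)"
    proof (cases "a = 0")
      case True
      then have "strip1 (a # w) = strip1 w" by (simp add: strip1_def)
      then show ?thesis
        using congr_gen_append_right[OF congr_gen_rule[OF zero], of v] v True by simp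
    next
      case False
      then have "([a, 0], [a]) \<in> one_rels A R"
        using Cons.hyps(1) by (auto simp: one_alph_def one_rels_def)
      from congr_gen_rule[OF this] show ?thesis
        using False by (auto simp: strip1_def congr_gen.refl)
    qed
    with IH show ?thesis by (rule congr_gen.trans)
  qed
qed simp

lemma congr_one_iff:
  assumes "v \<in> lists (one_alph A)" "v \<noteq> []" "w \<in> lists (one_alph A)" "w \<noteq> []"
  shows "(v, w) \<in> congr_gen (one_rels A R) \<longleftrightarrow> (strip v, strip w) \<in> congr_gen R"
proof
  assume congr: "(strip v, strip w) \<in> congr_gen R"
  have "congr_gen R \<subseteq> congr_gen (one_rels A R)"
    by (rule congr_gen_subsetI) (auto simp: one_rels_def intro: congr_gen_rule)
  then have "(strip1 v, strip1 w) \<in> congr_gen (one_rels A R)"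
    using congr congr_Nil_iff[OF congr] by (auto simp: strip1_def intro: congr_gen.refl)
  then show "(v, w) \<in> congr_gen (one_rels A R)"
    using congr_strip1[OF assms(1,2)] congr_strip1[OF assms(3,4)]
    by (blast intro: congr_gen.trans congr_gen.sym)
qed (rule strip_congr)

definition one_codes :: "nat list list set" where
  "one_codes = insert [[0]] L"

lemma concat_one_code:
  assumes "\<alpha> \<in> one_codes"
  shows "concat \<alpha> \<in> lists (one_alph A)" "concat \<alpha> \<noteq> []"
proof -
  have "concat \<alpha> \<in> lists (one_alph A) \<and> concat \<alpha> \<noteq> []" if "\<alpha> \<in> L"
    using lists_one_alph concat_code_in_lists[OF that] concat_code_nonempty[OF that] by blast
  then show "concat \<alpha> \<in> lists (one_alph A)" "concat \<alpha> \<noteq> []"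
    using assms by (auto simp: one_codes_def one_alph_def)
qed

lemma right_mult_rel_one_codes:
  assumes "w \<in> lists (one_alph A)"
  shows "right_mult_rel (one_rels A R) one_codes w = {(\<alpha>, \<beta>). \<alpha> \<in> one_codes \<and> \<beta> \<in> one_codes \<and>
    (strip (concat \<alpha>) @ strip w, strip (concat \<beta>)) \<in> congr_gen R}"
proof -
  have "(concat \<alpha> @ w, concat \<beta>) \<in> congr_gen (one_rels A R)
      \<longleftrightarrow> (strip (concat \<alpha>) @ strip w, strip (concat \<beta>)) \<in> congr_gen R"
    if "\<alpha> \<in> one_codes" "\<beta> \<in> one_codes" for \<alpha> \<beta>
    using congr_one_iff[of "concat \<alpha> @ w" "concat \<beta>"] that assms concat_one_code by simp
  then show ?thesis unfolding right_mult_rel_def by blast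
qed

lemma strip_concat_code: "\<alpha> \<in> L \<Longrightarrow> strip (concat \<alpha>) = concat \<alpha>"
  by (rule strip_id) (rule concat_code_in_lists)

lemma zero_code_notin: "[[0]] \<notin> L"
  using concat_code_in_lists[of "[[0]]"] zero_notin by auto

lemma right_mult_rel_one_if_strip_Nil:
  assumes "w \<in> lists (one_alph A)" "strip w = []"
  shows "right_mult_rel (one_rels A R) one_codes w = right_mult_rel R L [] \<union> {([[0]], [[0]])}"
proof -
  have "(concat \<beta>, []) \<notin> congr_gen R" "([], concat \<beta>) \<notin> congr_gen R" if "\<beta> \<in> L" for \<beta>
    using congr_Nil_iff concat_code_nonempty[OF that] by blast+
  then show ?thesis
    unfolding right_mult_rel_one_codes[OF assms(1)] assms(2)
    by (auto simp: one_codes_def right_mult_rel_def strip_concat_code congr_gen.refl)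
qed

lemma automatic_rel_one_if_strip_Nil:
  "w \<in> lists (one_alph A) \<Longrightarrow> strip w = []
    \<Longrightarrow> automatic_rel (right_mult_rel (one_rels A R) one_codes w)"
  by (simp only: right_mult_rel_one_if_strip_Nil automatic_rel_Un automatic_rel_equal
      automatic_rel_finite finite.intros)

lemma right_mult_rel_one_letter:
  assumes "a \<in> A" and \<gamma>: "\<gamma> \<in> L" "([a], concat \<gamma>) \<in> congr_gen R"
  shows "right_mult_rel (one_rels A R) one_codes [a]
    = right_mult_rel R L [a] \<union> {([[0]], \<gamma>)} O right_mult_rel R L []"
proof -
  have "a \<noteq> 0" using assms(1) zero_notin by metis
  moreover have "[a] \<in> lists (one_alph A)" using assms(1) by (simp add: one_alph_def)
  moreover have "(w @ [a], []) \<notin> congr_gen R" "([a], []) \<notin> congr_gen R" for w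
    using congr_Nil_iff by blast+
  moreover have "([a], concat \<beta>) \<in> congr_gen R \<longleftrightarrow> (concat \<gamma>, concat \<beta>) \<in> congr_gen R" for \<beta>
    using \<gamma>(2) by (blast intro: congr_gen.trans congr_gen.sym)
  ultimately show ?thesis
    unfolding right_mult_rel_one_codes[OF \<open>[a] \<in> lists (one_alph A)\<close>]
    using \<gamma>(1) zero_code_notin
    by (auto simp: right_mult_rel_def one_codes_def strip_concat_code)
qed

lemma represented_one:
  assumes "w \<in> lists (one_alph A)" "w \<noteq> []"
  shows "\<exists>\<alpha>\<in>one_codes. (w, concat \<alpha>) \<in> congr_gen (one_rels A R)"
proof -
  have "\<exists>\<alpha>\<in>one_codes. (strip w, strip (concat \<alpha>)) \<in> congr_gen R"
  proof (cases "strip w = []")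
    case True
    then show ?thesis by (auto simp: one_codes_def congr_gen.refl)
  next
    case False
    with represented[OF strip_in_lists[OF assms(1)]] show ?thesis
      by (auto simp: one_codes_def strip_concat_code)
  qed
  then show ?thesis using congr_one_iff[OF assms] concat_one_code by blast
qed

lemma automatic_rel_one_letter:
  assumes "a \<in> one_alph A"
  shows "automatic_rel (right_mult_rel (one_rels A R) one_codes [a])"
proof (cases "a = 0")
  case True
  then show ?thesis using assms by (intro automatic_rel_one_if_strip_Nil) auto
next
  case False
  then have "a \<in> A" using assms by (simp add: one_alph_def)
  then obtain \<gamma> where "\<gamma> \<in> L" "([a], concat \<gamma>) \<in> congr_gen R" using represented[of "[a]"] by auto
  from right_mult_rel_one_letter[OF \<open>a \<in> A\<close> this] show ?thesis
    by (simp only: automatic_rel_Un automatic_rel_relcomp automatic_rel_mult_letter[OF \<open>a \<in> A\<close>]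
        automatic_rel_equal automatic_rel_finite finite.intros)
qed

sublocale one: word_coding "one_alph A" "one_rels A R" "insert [0] B" one_codes
proof
  show "insert [0] B \<subseteq> lists (one_alph A) - {[]}"
    using blocks_subset by (auto simp: one_alph_def)
  show "one_codes \<subseteq> lists (insert [0] B) - {[]}"
    using codes_subset by (auto simp: one_codes_def)
  show "recognizable one_codes"
    using recognizable_Un[OF recognizable_singleton recognizable_codes] by (simp add: one_codes_def)
  show "automatic_rel (right_mult_rel (one_rels A R) one_codes [])"
    by (rule automatic_rel_one_if_strip_Nil) simp_all
qed (simp_all add: finite_blocks represented_one automatic_rel_one_letter)

lemma prefix_automatic_one_if_prefix_closed:
  assumes "\<And>\<alpha> \<beta>. \<alpha> @ \<beta> \<in> L \<Longrightarrow> \<alpha> \<noteq> [] \<Longrightarrow> \<alpha> \<in> L"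
  shows "prefix_automatic (sgp_carrier (one_alph A) (one_rels A R)) one.mult"
proof (rule one.prefix_automatic_if_prefix_closed)
  fix \<alpha> \<beta> assume "\<alpha> @ \<beta> \<in> one_codes" "\<alpha> \<noteq> []"
  then show "\<alpha> \<in> one_codes" using assms by (auto simp: one_codes_def append_eq_Cons_conv)
qed

end

section \<open>Unique normal forms from a one-element basis\<close>

lemma joinable_if_connected_below:
  fixes r less :: "'a \<Rightarrow> 'a \<Rightarrow> bool"
  assumes "equivclp (\<lambda>s t. r s t \<and> less s w) p q"
    and confluent_below:
      "\<And>s p q. less s w \<Longrightarrow> r\<^sup>*\<^sup>* s p \<Longrightarrow> r\<^sup>*\<^sup>* s q \<Longrightarrow> \<exists>u. r\<^sup>*\<^sup>* p u \<and> r\<^sup>*\<^sup>* q u"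
  shows "\<exists>u. r\<^sup>*\<^sup>* p u \<and> r\<^sup>*\<^sup>* q u"
  using assms(1)
proof (induction rule: equivclp_induct)
  case (step s t)
  then obtain u where u: "r\<^sup>*\<^sup>* p u" "r\<^sup>*\<^sup>* s u" by blast
  from step(2) show ?case
  proof
    assume "r s t \<and> less s w"
    then obtain v where "r\<^sup>*\<^sup>* u v" "r\<^sup>*\<^sup>* t v" using confluent_below[of s u t] u(2) by blast
    then show ?thesis using u(1) by (meson rtranclp_trans)
  next
    assume "r t s \<and> less t w"
    then show ?thesis using u by (meson converse_rtranclp_into_rtranclp)
  qed
qed blast

lemma confluentp_if_peaks_connected_below:
  fixes r less :: "'a \<Rightarrow> 'a \<Rightarrow> bool"
  assumes "wfp less" and decreasing: "\<And>p q. r p q \<Longrightarrow> less q p"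
    and peak: "\<And>w p q. r w p \<Longrightarrow> r w q \<Longrightarrow> equivclp (\<lambda>s t. r s t \<and> less s w) p q"
  shows "confluentp r"
proof (rule confluentpI)
  show "\<exists>u. r\<^sup>*\<^sup>* p u \<and> r\<^sup>*\<^sup>* q u" if "r\<^sup>*\<^sup>* w p" "r\<^sup>*\<^sup>* w q" for w p q
    using that
  proof (induction w arbitrary: p q rule: wfp_induct_rule[OF assms(1)])
    case (1 w)
    show ?case
    proof (cases "p = w \<or> q = w")
      case True
      then show ?thesis using "1.prems" by blast
    next
      case False
      then obtain p' q' where p': "r w p'" "r\<^sup>*\<^sup>* p' p" and q': "r w q'" "r\<^sup>*\<^sup>* q' q"
        using "1.prems" by (metis converse_rtranclpE)
      have "\<exists>u. r\<^sup>*\<^sup>* p' u \<and> r\<^sup>*\<^sup>* q' u"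
        using peak[OF p'(1) q'(1)] "1.IH" by (rule joinable_if_connected_below)
      then obtain u where u: "r\<^sup>*\<^sup>* p' u" "r\<^sup>*\<^sup>* q' u" by blast
      obtain v where v: "r\<^sup>*\<^sup>* p v" "r\<^sup>*\<^sup>* u v"
        using "1.IH"[OF decreasing[OF p'(1)] p'(2) u(1)] by blast
      then have "r\<^sup>*\<^sup>* q' v" using u(2) by simp
      then obtain z where "r\<^sup>*\<^sup>* q z" "r\<^sup>*\<^sup>* v z"
        using "1.IH"[OF decreasing[OF q'(1)] q'(2)] by blast
      then show ?thesis using v(1) by (meson rtranclp_trans)
    qed
  qed
qed

lemma ex_normal_form:
  fixes r less :: "'a \<Rightarrow> 'a \<Rightarrow> bool"
  assumes "wfp less" and "\<And>p q. r p q \<Longrightarrow> less q p"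
  shows "\<exists>n. r\<^sup>*\<^sup>* w n \<and> (\<nexists>q. r n q)"
proof (induction w rule: wfp_induct_rule[OF assms(1)])
  case (1 w)
  show ?case
  proof (cases "\<exists>q. r w q")
    case True
    then show ?thesis using 1 assms(2) by (meson converse_rtranclp_into_rtranclp)
  qed blast
qed

lemma ex1_normal_form:
  fixes r less :: "'a \<Rightarrow> 'a \<Rightarrow> bool"
  assumes "wfp less" and "\<And>p q. r p q \<Longrightarrow> less q p" and "confluentp r"
  shows "\<exists>!n. equivclp r w n \<and> (\<nexists>q. r n q)"
proof (rule ex_ex1I)
  show "\<exists>n. equivclp r w n \<and> (\<nexists>q. r n q)"
    using ex_normal_form[OF assms(1,2), of r w] rtranclp_into_equivclp[of r w] by blast
next
  fix m n assume "equivclp r w m \<and> (\<nexists>q. r m q)" "equivclp r w n \<and> (\<nexists>q. r n q)"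
  then have normal: "\<nexists>q. r m q" "\<nexists>q. r n q" and "equivclp r m n"
    by (auto intro: equivclp_trans equivclp_sym)
  then obtain u where "r\<^sup>*\<^sup>* m u" "r\<^sup>*\<^sup>* n u"
    using semiconfluentp_equivclp[OF confluentp_imp_semiconfluentp[OF assms(3)]]
    by (auto simp: rtranclp_conversep)
  then show "m = n" using normal by (metis converse_rtranclpE)
qed

definition rewrite :: "'a list \<Rightarrow> 'a list \<Rightarrow> 'a list \<Rightarrow> 'a list \<Rightarrow> bool" where
  "rewrite U V p q \<longleftrightarrow> (\<exists>l r. p = l @ U @ r \<and> q = l @ V @ r)"

definition unique_normal_forms :: "'a list \<Rightarrow> 'a list \<Rightarrow> bool" where
  "unique_normal_forms U V \<longleftrightarrow> (\<forall>w. \<exists>!n. (w, n) \<in> congr_gen {(U, V)} \<and> \<not> sublist U n)"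

lemma rewrite_context: "rewrite U V p q \<Longrightarrow> rewrite U V (l @ p @ r) (l @ q @ r)"
  unfolding rewrite_def by (metis append.assoc)

lemma sublist_iff_rewrite: "sublist U w \<longleftrightarrow> (\<exists>q. rewrite U V w q)"
  by (auto simp: sublist_def rewrite_def)

lemma congr_gen_iff_equivclp_rewrite: "(p, q) \<in> congr_gen {(U, V)} \<longleftrightarrow> equivclp (rewrite U V) p q"
proof
  assume "(p, q) \<in> congr_gen {(U, V)}"
  then show "equivclp (rewrite U V) p q"
  proof induction
    case (base u v l r)
    then show ?case by (auto simp: rewrite_def)
  qed (auto intro: equivclp_sym equivclp_trans)
next
  have rewrite_congr: "(s, t) \<in> congr_gen {(U, V)}" if "rewrite U V s t" for s t
    using that by (auto simp: rewrite_def intro: congr_gen.base)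
  assume "equivclp (rewrite U V) p q"
  then show "(p, q) \<in> congr_gen {(U, V)}"
    by induction (blast intro: congr_gen.refl congr_gen.trans congr_gen.sym rewrite_congr)+
qed

lemma append_eq_append_leE:
  assumes "a @ b = c @ d" "length a \<le> length c"
  obtains m where "c = a @ m" "b = m @ d"
  using assms by (metis append_eq_append_conv_if append_take_drop_id)

locale word_order =
  fixes less :: "'a list \<Rightarrow> 'a list \<Rightarrow> bool"
  assumes wfp_less: "wfp less" and less_context: "less v w \<Longrightarrow> less (l @ v @ r) (l @ w @ r)"
begin

definition connected_below :: "'a list \<Rightarrow> 'a list \<Rightarrow> 'a list \<Rightarrow> 'a list \<Rightarrow> 'a list \<Rightarrow> bool" where
  "connected_below U V w = equivclp (\<lambda>s t. rewrite U V s t \<and> less s w)"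

lemma connected_belowI: "rewrite U V p q \<Longrightarrow> less p w \<Longrightarrow> connected_below U V w p q"
  unfolding connected_below_def by blast

lemma connected_below_sym: "connected_below U V w p q \<Longrightarrow> connected_below U V w q p"
  unfolding connected_below_def by (rule equivclp_sym)

lemma connected_below_trans:
  "connected_below U V w p q \<Longrightarrow> connected_below U V w q s \<Longrightarrow> connected_below U V w p s"
  unfolding connected_below_def by (rule equivclp_trans)

lemma connected_below_context:
  assumes "connected_below U V w p q"
  shows "connected_below U V (l @ w @ r) (l @ p @ r) (l @ q @ r)"
  using assms unfolding connected_below_def
proof induction
  case (step s t)
  from step(2) show ?case
    by (intro equivclp_into_equivclp[OF step(3)]) (auto intro: rewrite_context less_context)
qed simp

definition overlaps_connected :: "'a list \<Rightarrow> 'a list \<Rightarrow> bool" where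
  "overlaps_connected U V \<longleftrightarrow> (\<forall>a b. U @ b = a @ U \<longrightarrow> length b < length U \<longrightarrow>
     connected_below U V (U @ b) (V @ b) (a @ V))"

lemma connected_below_disjoint:
  assumes "less V U"
  shows "connected_below U V (l @ U @ m @ U @ r) (l @ V @ m @ U @ r) (l @ U @ m @ V @ r)"
proof (rule connected_below_trans)
  have "rewrite U V (l @ V @ m @ U @ r) (l @ V @ m @ V @ r)"
    unfolding rewrite_def by (metis append.assoc)
  then show "connected_below U V (l @ U @ m @ U @ r) (l @ V @ m @ U @ r) (l @ V @ m @ V @ r)"
    using less_context[OF assms] by (rule connected_belowI)
  have "rewrite U V (l @ U @ m @ V @ r) (l @ V @ m @ V @ r)" by (auto simp: rewrite_def)
  moreover have "less (l @ U @ m @ V @ r) (l @ U @ m @ U @ r)"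
    using less_context[OF assms, of "l @ U @ m" r] by simp
  ultimately show "connected_below U V (l @ U @ m @ U @ r) (l @ V @ m @ V @ r) (l @ U @ m @ V @ r)"
    by (intro connected_below_sym[OF connected_belowI])
qed

lemma connected_below_peak_le:
  assumes "less V U" "overlaps_connected U V"
    and eq: "l @ U @ r = l' @ U @ r'" and "length l \<le> length l'"
  shows "connected_below U V (l @ U @ r) (l @ V @ r) (l' @ V @ r')"
proof -
  obtain m where m: "l' = l @ m" "U @ r = m @ U @ r'"
    by (rule append_eq_append_leE[OF eq assms(4)])
  show ?thesis
  proof (cases "length U \<le> length m")
    case True
    with m(2) obtain m' where "m = U @ m'" "r = m' @ U @ r'" by (rule append_eq_append_leE)
    then show ?thesis using connected_below_disjoint[OF assms(1)] by (simp add: m(1))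
  next
    case False
    obtain b where b: "m @ U = U @ b" "r = b @ r'"
      by (rule append_eq_append_leE[of U r "m @ U" r']) (use m(2) in simp_all)
    have "length b = length m" using arg_cong[OF b(1), of length] by simp
    then have "connected_below U V (U @ b) (V @ b) (m @ V)"
      using assms(2) b(1)[symmetric] False unfolding overlaps_connected_def by auto
    from connected_below_context[OF this, of l r'] show ?thesis by (simp add: m(1) b(2))
  qed
qed

lemma connected_below_peak:
  assumes "less V U" "overlaps_connected U V" and "rewrite U V w p" "rewrite U V w q"
  shows "connected_below U V w p q"
proof -
  obtain l r l' r' where w: "w = l @ U @ r" "p = l @ V @ r" "w = l' @ U @ r'" "q = l' @ V @ r'"
    using assms(3,4) unfolding rewrite_def by blast
  then have eq: "l @ U @ r = l' @ U @ r'" by simp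
  show ?thesis
    using connected_below_peak_le[OF assms(1,2) eq] w
      connected_below_sym[OF connected_below_peak_le[OF assms(1,2) eq[symmetric]]]
    by (metis linear)
qed

lemma unique_normal_forms_if_overlaps_connected:
  assumes "less V U" "overlaps_connected U V"
  shows "unique_normal_forms U V"
proof -
  have decreasing: "less q p" if "rewrite U V p q" for p q
    using that less_context[OF assms(1)] by (auto simp: rewrite_def)
  then have "confluentp (rewrite U V)"
    using connected_below_peak[OF assms] unfolding connected_below_def
    by (rule confluentp_if_peaks_connected_below[OF wfp_less])
  with wfp_less decreasing have "\<exists>!n. equivclp (rewrite U V) w n \<and> (\<nexists>q. rewrite U V n q)" for w
    by (rule ex1_normal_form)
  then show ?thesis
    unfolding unique_normal_forms_def congr_gen_iff_equivclp_rewrite sublist_iff_rewrite[of U _ V]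
    by blast
qed

end

lemma dlex_less_iff_lenlex: "dlex_less \<rho> v w \<longleftrightarrow> (v, w) \<in> lenlex (measure \<rho>)"
proof -
  have "{(a, b). \<rho> a < \<rho> b} = measure \<rho>" by auto
  then show ?thesis by (auto simp: dlex_less_def lenlex_conv lexord_lex)
qed

interpretation dlex: word_order "dlex_less \<rho>" for \<rho>
proof
  show "wfp (dlex_less \<rho>)"
    unfolding wfp_def dlex_less_iff_lenlex by (simp add: wf_lenlex)
next
  fix v w l r assume "dlex_less \<rho> v w"
  then consider "length v < length w" | "length v = length w" "(v, w) \<in> lexord {(a, b). \<rho> a < \<rho> b}"
    by (auto simp: dlex_less_def)
  then show "dlex_less \<rho> (l @ v @ r) (l @ w @ r)"
    by cases (auto simp: dlex_less_def intro!: lexord_append_leftI lexord_sufI)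
qed

lemma is_lead_unique: "is_lead \<rho> f v \<Longrightarrow> is_lead \<rho> f w \<Longrightarrow> v = w"
  unfolding is_lead_def using asympD[OF wfp_imp_asymp[OF dlex.wfp_less]] by metis

lemma lead_eq: "is_lead \<rho> f w \<Longrightarrow> lead \<rho> f = w"
  unfolding lead_def using is_lead_unique by blast

definition binom_poly :: "'k::field \<Rightarrow> nat list \<Rightarrow> nat list \<Rightarrow> nat list \<Rightarrow> 'k" where
  "binom_poly c U V w = c * ((if w = U then 1 else 0) - (if w = V then 1 else 0))"

lemma wmul_binom_poly: "wmul a (binom_poly c U V) b = binom_poly c (a @ U @ b) (a @ V @ b)"
proof
  fix w
  show "wmul a (binom_poly c U V) b w = binom_poly c (a @ U @ b) (a @ V @ b) w"
  proof (cases "\<exists>v. w = a @ v @ b")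
    case True
    then obtain v where v: "w = a @ v @ b" by blast
    then have "(THE v. w = a @ v @ b) = v" by auto
    then show ?thesis by (auto simp: wmul_def binom_poly_def v)
  qed (auto simp: wmul_def binom_poly_def)
qed

lemma sum_binom_poly:
  assumes "finite W" "U \<in> W" "V \<in> W"
  shows "(\<Sum>w\<in>W \<inter> C. binom_poly c U V w)
    = c * ((if U \<in> C then 1 else 0) - (if V \<in> C then 1 else 0))"
  using assms unfolding binom_poly_def
  by (simp add: sum_distrib_left[symmetric] sum_subtractf sum.delta)

text \<open>Summing coefficients over the connected component of \<open>p\<close> annihilates the right-hand
  side of a triviality certificate, but not \<open>p - q\<close> unless \<open>q\<close> lies in that component.\<close>

lemma connected_below_if_trivial_mod:
  fixes c d :: "'k::field"
  assumes lead: "lead \<rho> (binom_poly c U V) = U" and "d \<noteq> 0"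
    and trivial: "trivial_mod \<rho> A {binom_poly c U V} w (binom_poly d p q)"
  shows "dlex.connected_below \<rho> U V w p q"
proof (rule ccontr)
  assume not_connected: "\<not> dlex.connected_below \<rho> U V w p q"
  obtain m :: nat and \<alpha> :: "nat \<Rightarrow> 'k" and a s b where
    "\<forall>i<m. s i \<in> {binom_poly c U V} \<and> a i \<in> lists A \<and> b i \<in> lists A \<and>
        dlex_less \<rho> (a i @ lead \<rho> (s i) @ b i) w"
    and certificate: "\<forall>v. binom_poly d p q v = (\<Sum>i<m. \<alpha> i * wmul (a i) (s i) (b i) v)"
    using trivial unfolding trivial_mod_def by (elim exE conjE)
  then have s: "s i = binom_poly c U V" "dlex_less \<rho> (a i @ U @ b i) w" if "i < m" for i
    using that lead by auto
  define C where "C = {v. dlex.connected_below \<rho> U V w p v}"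
  define W where "W = {p, q} \<union> (\<lambda>i. a i @ U @ b i) ` {..<m} \<union> (\<lambda>i. a i @ V @ b i) ` {..<m}"
  have W: "finite W" "p \<in> W" "q \<in> W" by (simp_all add: W_def)
  have "(\<Sum>v\<in>W \<inter> C. wmul (a i) (s i) (b i) v) = 0" if "i < m" for i
  proof -
    have "dlex.connected_below \<rho> U V w (a i @ U @ b i) (a i @ V @ b i)"
      using s(2)[OF that] by (intro dlex.connected_belowI) (auto simp: rewrite_def)
    then have "a i @ U @ b i \<in> C \<longleftrightarrow> a i @ V @ b i \<in> C"
      unfolding C_def using dlex.connected_below_trans dlex.connected_below_sym by blast
    moreover have "a i @ U @ b i \<in> W" "a i @ V @ b i \<in> W" using that by (auto simp: W_def)
    ultimately show ?thesis by (simp add: s(1)[OF that] wmul_binom_poly sum_binom_poly[OF W(1)])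
  qed
  then have "(\<Sum>v\<in>W \<inter> C. binom_poly d p q v) = 0"
    unfolding certificate[rule_format] by (subst sum.swap) (simp add: sum_distrib_left[symmetric])
  moreover have "p \<in> C" "q \<notin> C"
    using not_connected by (simp_all add: C_def dlex.connected_below_def)
  then have "(\<Sum>v\<in>W \<inter> C. binom_poly d p q v) = d" by (simp add: sum_binom_poly[OF W])
  ultimately show False using \<open>d \<noteq> 0\<close> by simp
qed

lemma overlaps_connected_if_GSB:
  assumes lead: "is_lead \<rho> (binom_poly c U V) U" and GSB: "GSB \<rho> A {binom_poly c U V}"
    and U: "U \<in> lists A"
  shows "dlex.overlaps_connected \<rho> U V"
  unfolding dlex.overlaps_connected_def
proof (intro allI impI)
  fix a b assume eq: "U @ b = a @ U" and len: "length b < length U"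
  let ?f = "binom_poly c U V"
  have len_eq: "length a = length b" using arg_cong[OF eq, of length] by simp
  then have "a = take (length b) U" "b = drop (length U - length b) U"
    using arg_cong[OF eq, of "take (length b)"] arg_cong[OF eq, of "drop (length U)"] len
    by simp_all
  then have "a \<in> lists A" "b \<in> lists A"
    using U by (metis in_lists_conv_set in_set_takeD, metis in_lists_conv_set in_set_dropD)
  moreover have "U @ b = lead \<rho> ?f @ b \<and> U @ b = a @ lead \<rho> ?f \<and>
      length (U @ b) < length (lead \<rho> ?f) + length (lead \<rho> ?f)"
    using eq len len_eq lead_eq[OF lead] by simp
  ultimately have "trivial_mod \<rho> A {?f} (U @ b) (\<lambda>v. wmul [] ?f b v - wmul a ?f [] v)"
    using GSB unfolding GSB_def by blast
  moreover have "(\<lambda>v. wmul [] ?f b v - wmul a ?f [] v) = binom_poly (- c) (V @ b) (a @ V)"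
    by (rule ext) (simp add: wmul_binom_poly eq binom_poly_def algebra_simps)
  moreover have "c \<noteq> 0" using lead by (auto simp: is_lead_def binom_poly_def)
  ultimately show "dlex.connected_below \<rho> U V (U @ b) (V @ b) (a @ V)"
    by (auto intro!: connected_below_if_trivial_mod[OF lead_eq[OF lead], of "- c"])
qed

lemma unique_normal_forms_if_GSB:
  assumes lead: "is_lead \<rho> (binom_poly c U V) U" and "GSB \<rho> A {binom_poly c U V}" and "U \<in> lists A"
  shows "dlex_less \<rho> V U \<and> unique_normal_forms U V"
proof -
  have "U \<noteq> V" "c \<noteq> 0" using lead by (auto simp: is_lead_def binom_poly_def)
  then have "binom_poly c U V V \<noteq> 0" by (simp add: binom_poly_def)
  then have "dlex_less \<rho> V U" using lead \<open>U \<noteq> V\<close> unfolding is_lead_def by metis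
  then show ?thesis
    using overlaps_connected_if_GSB[OF assms] dlex.unique_normal_forms_if_overlaps_connected
    by blast
qed

lemma GSB_difference_cases:
  fixes u v :: "nat list"
  assumes GSB: "GSB \<rho> A
      {(\<lambda>w. (if w = u then 1 else 0) - (if w = v then 1 else 0)) :: nat list \<Rightarrow> 'k::field}"
    and "u \<in> lists A" "v \<in> lists A"
  obtains (decreasing) "dlex_less \<rho> v u" "unique_normal_forms u v"
    | (increasing) "dlex_less \<rho> u v" "unique_normal_forms v u"
proof -
  have u: "GSB \<rho> A {binom_poly (1 :: 'k) u v}" and v: "GSB \<rho> A {binom_poly (- 1 :: 'k) v u}"
    using GSB by (simp_all add: binom_poly_def[abs_def])
  then obtain w where w: "is_lead \<rho> (binom_poly (1 :: 'k) u v) w" by (auto simp: GSB_def monic_def)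
  then consider "w = u" | "w = v" by (auto simp: is_lead_def binom_poly_def split: if_splits)
  then show ?thesis
  proof cases
    case 1
    then show ?thesis using that(1) unique_normal_forms_if_GSB[OF _ u] w assms(2) by blast
  next
    case 2
    moreover have "binom_poly (1 :: 'k) u v = binom_poly (- 1) v u"
      by (simp add: binom_poly_def fun_eq_iff)
    ultimately show ?thesis using that(2) unique_normal_forms_if_GSB[OF _ v] w assms(3) by simp
  qed
qed

section \<open>Greedy compression of a block\<close>

declare suffix_snoc [simp del]

abbreviation singles :: "'a list \<Rightarrow> 'a list list" where
  "singles w \<equiv> map (\<lambda>a. [a]) w"

lemma concat_singles [simp]: "concat (singles w) = w"
  by (induction w) auto

lemma eventually_pumped_if_Suc:
  assumes "\<And>m. f (Suc m) = X @ g m" and "eventually_pumped g"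
  shows "eventually_pumped f"
proof -
  obtain N P b Q where "\<And>j. g (N + j) = P @ replicate j b @ Q"
    using assms(2) unfolding eventually_pumped_def by blast
  then have "\<forall>j. f (Suc N + j) = (X @ P) @ replicate j b @ Q" using assms(1) by simp
  then show ?thesis unfolding eventually_pumped_def by blast
qed

locale compression =
  fixes p :: "'a list"
  assumes block_nonempty: "p \<noteq> []"
begin

definition compress_step :: "'a list list \<Rightarrow> 'a \<Rightarrow> 'a list list" where
  "compress_step \<alpha> a = (let \<beta> = \<alpha> @ [[a]] in
     if suffix (singles p) \<beta> then take (length \<beta> - length p) \<beta> @ [p] else \<beta>)"

definition compress :: "'a list list \<Rightarrow> 'a list \<Rightarrow> 'a list list" where
  "compress = foldl compress_step"

lemma compress_Nil [simp]: "compress \<alpha> [] = \<alpha>"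
  by (simp add: compress_def)

lemma compress_Cons [simp]: "compress \<alpha> (a # w) = compress (compress_step \<alpha> a) w"
  by (simp add: compress_def)

lemma compress_append: "compress \<alpha> (v @ w) = compress (compress \<alpha> v) w"
  by (simp add: compress_def)

lemma compress_step_plain: "\<not> suffix (singles p) (\<alpha> @ [[a]]) \<Longrightarrow> compress_step \<alpha> a = \<alpha> @ [[a]]"
  by (simp add: compress_step_def Let_def)

lemma compress_step_complete: "\<alpha> @ [[a]] = E @ singles p \<Longrightarrow> compress_step \<alpha> a = E @ [p]"
  by (simp add: compress_step_def Let_def suffix_def)

lemma compress_step_cases:
  obtains (plain) "\<not> suffix (singles p) (\<alpha> @ [[a]])" "compress_step \<alpha> a = \<alpha> @ [[a]]"
    | (complete) E where "\<alpha> @ [[a]] = E @ singles p" "compress_step \<alpha> a = E @ [p]"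
proof (cases "suffix (singles p) (\<alpha> @ [[a]])")
  case True
  then obtain E where "\<alpha> @ [[a]] = E @ singles p" by (auto simp: suffix_def)
  from complete[OF this compress_step_complete[OF this]] show ?thesis .
next
  case False
  from plain[OF this compress_step_plain[OF this]] show ?thesis .
qed

lemma concat_compress_step: "concat (compress_step \<alpha> a) = concat \<alpha> @ [a]"
proof (cases \<alpha> a rule: compress_step_cases)
  case (complete E)
  have "concat \<alpha> @ [a] = concat E @ p" using arg_cong[OF complete(1), of concat] by simp
  then show ?thesis using complete(2) by simp
qed simp

lemma concat_compress: "concat (compress \<alpha> w) = concat \<alpha> @ w"
  by (induction w arbitrary: \<alpha>) (simp_all add: concat_compress_step)

definition blocks :: "'a set \<Rightarrow> 'a list set" where
  "blocks A = insert p ((\<lambda>a. [a]) ` A)"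

lemma compress_in_lists:
  assumes "\<alpha> \<in> lists (blocks A)" "w \<in> lists A"
  shows "compress \<alpha> w \<in> lists (blocks A)"
  using assms
proof (induction w arbitrary: \<alpha>)
  case (Cons a w)
  have "compress_step \<alpha> a \<in> lists (blocks A)"
  proof (cases \<alpha> a rule: compress_step_cases)
    case plain
    then show ?thesis using Cons.prems by (simp add: blocks_def)
  next
    case (complete E)
    moreover have "\<alpha> @ [[a]] \<in> lists (blocks A)" using Cons.prems by (simp add: blocks_def)
    ultimately show ?thesis by (simp add: blocks_def)
  qed
  then show ?case using Cons by simp
qed simp

lemma prefix_compress_step:
  assumes "prefix \<beta> (compress_step \<alpha> a)"
  shows "\<beta> = compress_step \<alpha> a \<or> prefix \<beta> \<alpha>"
proof (cases \<alpha> a rule: compress_step_cases)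
  case plain
  then show ?thesis using assms by simp
next
  case (complete E)
  obtain q b where "p = q @ [b]" using block_nonempty by (cases p rule: rev_cases) auto
  then have "\<alpha> = E @ singles q" using complete(1) by simp
  moreover have "\<beta> = E @ [p] \<or> prefix \<beta> E" using assms unfolding complete(2) prefix_snoc .
  ultimately show ?thesis using complete(2) by auto
qed

lemma prefix_compress:
  "prefix \<beta> (compress [] w) \<Longrightarrow> \<exists>v. prefix v w \<and> \<beta> = compress [] v"
proof (induction w rule: rev_induct)
  case (snoc a w)
  then have "\<beta> = compress [] (w @ [a]) \<or> prefix \<beta> (compress [] w)"
    using prefix_compress_step[of \<beta> "compress [] w" a] by (simp add: compress_append)
  then show ?case using snoc.IH by (metis prefix_order.refl prefix_snoc)
qed simp

lemma compress_single_letter: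
  assumes "length p = 1"
  shows "compress \<alpha> w = \<alpha> @ singles w"
proof (induction w arbitrary: \<alpha>)
  case (Cons a w)
  have "singles p = [p]" using assms by (auto simp: length_Suc_conv)
  then have "compress_step \<alpha> a = \<alpha> @ [[a]]" by (cases \<alpha> a rule: compress_step_cases) auto
  then show ?case using Cons by simp
qed simp

lemma two_le_length_block: "length p \<noteq> 1 \<Longrightarrow> 2 \<le> length p"
  using block_nonempty by (cases p rule: remdups_adj.cases) auto

lemma suffix_after_block_iff:
  assumes "2 \<le> length p"
  shows "suffix (singles p) (E @ [p] @ s) \<longleftrightarrow> suffix (singles p) s"
proof
  assume suf: "suffix (singles p) (E @ [p] @ s)"
  have "suffix s (E @ [p] @ s)" by (simp add: suffix_def)
  show "suffix (singles p) s"
  proof (cases "length p \<le> length s")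
    case True
    then show ?thesis using suf \<open>suffix s _\<close> by (auto intro: suffix_length_suffix)
  next
    case False
    moreover have "suffix ([p] @ s) (E @ [p] @ s)" by (simp add: suffix_def)
    ultimately have "suffix ([p] @ s) (singles p)" using suf by (auto intro: suffix_length_suffix)
    then have "p \<in> set (singles p)" by (auto dest!: set_mono_suffix)
    then show ?thesis using assms by auto
  qed
qed (metis suffix_appendI)

lemma compress_context:
  assumes "2 \<le> length p"
    and "\<And>e. suffix (singles p) (\<delta> @ s @ e) \<Longrightarrow> suffix (singles p) (s @ e)"
  shows "compress (\<delta> @ s) w = \<delta> @ compress s w"
  using assms(2)
proof (induction w arbitrary: s)
  case (Cons a w)
  have "compress_step (\<delta> @ s) a = \<delta> @ compress_step s a \<and>
    (\<forall>e. suffix (singles p) (\<delta> @ compress_step s a @ e)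
      \<longrightarrow> suffix (singles p) (compress_step s a @ e))"
  proof (cases s a rule: compress_step_cases)
    case plain
    then have "compress_step (\<delta> @ s) a = (\<delta> @ s) @ [[a]]"
      using Cons.prems[of "[[a]]"] by (intro compress_step_plain) auto
    then show ?thesis using Cons.prems[of "[a] # _"] by (simp add: plain(2))
  next
    case (complete E)
    then have "compress_step (\<delta> @ s) a = (\<delta> @ E) @ [p]" by (intro compress_step_complete) simp
    moreover have "suffix (singles p) (\<delta> @ E @ [p] @ e) \<longleftrightarrow> suffix (singles p) (E @ [p] @ e)" for e
      using suffix_after_block_iff[OF assms(1), of "\<delta> @ E" e]
        suffix_after_block_iff[OF assms(1), of E e] by simp
    ultimately show ?thesis using complete(2) by simp
  qed
  then show ?case using Cons.IH[of "compress_step s a"] by simp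
qed simp

lemma compress_after_block:
  assumes "2 \<le> length p"
  shows "compress (E @ [p] @ s) w = E @ [p] @ compress s w"
  using compress_context[OF assms, of "E @ [p]" s w]
    suffix_after_block_iff[OF assms] suffix_appendI by fastforce

lemma compress_locality:
  obtains \<delta> s where "\<alpha> = \<delta> @ s" "length s \<le> length p" "\<forall>w. compress \<alpha> w = \<delta> @ compress s w"
proof (cases "length p = 1")
  case True
  then show ?thesis using that[of \<alpha> "[]"] by (simp add: compress_single_letter)
next
  case False
  note long = two_le_length_block[OF this]
  define \<delta> s where "\<delta> = take (length \<alpha> - length p) \<alpha>" and "s = drop (length \<alpha> - length p) \<alpha>"
  have \<alpha>: "\<alpha> = \<delta> @ s" "length s \<le> length p" by (simp_all add: \<delta>_def s_def)
  have "compress (\<delta> @ s) w = \<delta> @ compress s w" for w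
  proof (rule compress_context[OF long])
    fix e assume suf: "suffix (singles p) (\<delta> @ s @ e)"
    show "suffix (singles p) (s @ e)"
    proof (cases "length p \<le> length s")
      case True
      have "suffix (s @ e) (\<delta> @ s @ e)" by (simp add: suffix_def)
      with suf show ?thesis by (rule suffix_length_suffix) (simp add: True trans_le_add1)
    next
      case False
      then have "\<delta> = []" by (simp add: \<delta>_def s_def)
      then show ?thesis using suf by simp
    qed
  qed
  then show ?thesis using that[of \<delta> s] \<alpha> by simp
qed

subsection \<open>Compressing powers\<close>

lemma compress_short_cases:
  assumes "2 \<le> length p" "length w \<le> length p"
  obtains (plain) "compress t w = t @ singles w" "w = [] \<or> \<not> suffix (singles p) (t @ singles w)"
    | (completed) E r q where "w = r @ q" "r \<noteq> []" "E @ singles p = t @ singles r"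
        "compress t w = E @ [p] @ singles q"
  using assms(2)
proof (induction w arbitrary: thesis rule: rev_induct)
  case (snoc a w)
  have "length w \<le> length p" using snoc.prems(3) by simp
  show ?case
  proof (rule snoc.IH[OF _ _ \<open>length w \<le> length p\<close>])
    assume plain: "compress t w = t @ singles w"
    show ?thesis
    proof (cases "t @ singles w" a rule: compress_step_cases)
      case plain': plain
      then show ?thesis using snoc.prems(1) plain by (simp add: compress_append)
    next
      case (complete E)
      then show ?thesis
        using snoc.prems(2)[of "w @ [a]" "[]" E] plain by (simp add: compress_append)
    qed
  next
    fix E r q
    assume completed: "w = r @ q" "r \<noteq> []" "E @ singles p = t @ singles r"
      "compress t w = E @ [p] @ singles q"
    then have "length (q @ [a]) < length p" using snoc.prems(3) by (cases r) auto
    then have "\<not> suffix (singles p) (singles (q @ [a]))" by (auto dest: suffix_length_le)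
    then have "\<not> suffix (singles p) ((E @ [p] @ singles q) @ [[a]])"
      using suffix_after_block_iff[OF assms(1), of E "singles (q @ [a])"] by simp
    from compress_step_plain[OF this] show ?thesis
      using snoc.prems(2)[of r "q @ [a]" E] completed by (simp add: compress_append)
  qed
qed simp

lemma compress_block:
  assumes "2 \<le> length p"
  obtains E r q where "p = r @ q" "r \<noteq> []" "E @ singles p = t @ singles r"
    "compress t p = E @ [p] @ singles q"
proof (rule compress_short_cases[OF assms order.refl, of t])
  assume "p = [] \<or> \<not> suffix (singles p) (t @ singles p)"
  then show ?thesis using block_nonempty by (simp add: suffix_def)
qed (rule that)

lemma eventually_pumped_compress_power_suffix:
  assumes "2 \<le> length p" and "p = r @ q" "r \<noteq> []"
  shows "eventually_pumped (\<lambda>m. compress (singles q) (concat (replicate m p)))"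
  using assms(2,3)
proof (induction "length q" arbitrary: r q rule: less_induct)
  case less
  obtain E r' q' where q': "p = r' @ q'" "r' \<noteq> []" "E @ singles p = singles q @ singles r'"
      "compress (singles q) p = E @ [p] @ singles q'"
    by (rule compress_block[OF assms(1)])
  have lengths: "length E + length q' = length q"
    using arg_cong[OF q'(3), of length] arg_cong[OF q'(1), of length] by simp
  have step: "compress (singles q) (concat (replicate (Suc m) p))
      = (E @ [p]) @ compress (singles q') (concat (replicate m p))" for m
    using compress_after_block[OF assms(1), of E "singles q'"] by (simp add: compress_append q'(4))
  show ?case
  proof (cases "length q' < length q")
    case True
    from step less.hyps[OF this q'(1,2)] show ?thesis by (rule eventually_pumped_if_Suc)
  next
    case False
    then have "length E = 0" "length q' = length q" using lengths by linarith+
    then have "E = []" by simp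
    have "r @ q = r' @ q'" using q'(1) less.prems(1) by simp
    then have "q' = q" using \<open>length q' = length q\<close> by simp
    then have "compress (singles q) (concat (replicate m p)) = replicate m p @ singles q" for m
      using step \<open>E = []\<close> by (induction m) simp_all
    then have "\<forall>m. compress (singles q) (concat (replicate (0 + m) p))
        = [] @ replicate m p @ singles q"
      by simp
    then show ?thesis unfolding eventually_pumped_def by blast
  qed
qed

lemma eventually_pumped_compress_power:
  "eventually_pumped (\<lambda>m. compress t (concat (replicate m p)))"
proof (cases "length p = 1")
  case True
  have "singles (concat (replicate m p)) = replicate m p" for m
    using True by (induction m) (auto simp: length_Suc_conv)
  then have "\<forall>m. compress t (concat (replicate (0 + m) p)) = t @ replicate m p @ []"
    by (simp add: compress_single_letter[OF True])
  then show ?thesis unfolding eventually_pumped_def by blast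
next
  case False
  note long = two_le_length_block[OF this]
  obtain E r q where q: "p = r @ q" "r \<noteq> []" "compress t p = E @ [p] @ singles q"
    by (rule compress_block[OF long])
  have "compress t (concat (replicate (Suc m) p))
      = (E @ [p]) @ compress (singles q) (concat (replicate m p))" for m
    using compress_after_block[OF long, of E "singles q"] by (simp add: compress_append q(3))
  then show ?thesis
    using eventually_pumped_compress_power_suffix[OF long q(1,2)] by (rule eventually_pumped_if_Suc)
qed

lemma compress_step_letter_power:
  assumes "p \<noteq> replicate (length p) y" "length p \<le> i"
  shows "compress t (replicate (Suc i) y) = compress t (replicate i y) @ [[y]]"
proof -
  have snoc: "replicate (Suc i) y = replicate i y @ [y]" by (simp add: replicate_append_same)
  show ?thesis
  proof (cases "compress t (replicate i y)" y rule: compress_step_cases)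
    case plain
    then show ?thesis unfolding snoc compress_append by simp
  next
    case (complete E)
    have "concat E @ p = concat t @ replicate (Suc i) y"
      using arg_cong[OF complete(1), of concat] by (simp add: concat_compress replicate_append_same)
    also have "replicate (Suc i) y = replicate (Suc i - length p) y @ replicate (length p) y"
      using assms(2) by (simp flip: replicate_add)
    finally have "concat E @ p
        = (concat t @ replicate (Suc i - length p) y) @ replicate (length p) y"
      by simp
    then have "p = replicate (length p) y" by (metis append_eq_append_conv length_replicate)
    with assms(1) show ?thesis by blast
  qed
qed

lemma eventually_pumped_compress_letter_power:
  assumes "p \<noteq> replicate (length p) y"
  shows "eventually_pumped (\<lambda>m. compress t (replicate m y))"
proof -
  have "compress t (replicate (length p + j) y)
      = compress t (replicate (length p) y) @ replicate j [y] @ []" for j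
  proof (induction j)
    case (Suc j)
    then show ?case
      using compress_step_letter_power[OF assms, of "length p + j" t]
      by (simp add: replicate_append_same)
  qed simp
  then show ?thesis unfolding eventually_pumped_def by blast
qed

subsection \<open>The language of compressed words\<close>

definition short_states :: "'a set \<Rightarrow> 'a list list set" where
  "short_states A = {s. set s \<subseteq> blocks A \<and> length s \<le> length p}"

lemma finite_short_states: "finite A \<Longrightarrow> finite (short_states A)"
  unfolding short_states_def blocks_def by (intro finite_lists_length_le) simp

lemma compress_common_prefix:
  assumes "w \<in> lists A"
  obtains s where "s \<in> short_states A"
    "\<And>z z' T. (compress s z, compress s z') \<in> T
      \<Longrightarrow> (compress [] (w @ z), compress [] (w @ z')) \<in> common_prefix_closure T"
proof -
  obtain \<delta> s where s: "compress [] w = \<delta> @ s" "length s \<le> length p"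
      "\<forall>z. compress (compress [] w) z = \<delta> @ compress s z"
    by (rule compress_locality)
  have "compress [] w \<in> lists (blocks A)" using assms by (intro compress_in_lists) simp_all
  then have "s \<in> short_states A" using s(1,2) by (auto simp: short_states_def)
  then show ?thesis
    using s(3) by (intro that[of s]) (auto simp: compress_append common_prefix_closure_def)
qed

lemma compress_Nil_concat_iff:
  assumes "p \<in> lists A"
  shows "\<alpha> \<in> compress [] ` lists A \<longleftrightarrow> \<alpha> \<in> lists (blocks A) \<and> compress [] (concat \<alpha>) = \<alpha>"
proof
  assume "\<alpha> \<in> compress [] ` lists A"
  then show "\<alpha> \<in> lists (blocks A) \<and> compress [] (concat \<alpha>) = \<alpha>"
    using compress_in_lists[of "[]"] by (auto simp: concat_compress simp del: in_lists_conv_set)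
next
  assume \<alpha>: "\<alpha> \<in> lists (blocks A) \<and> compress [] (concat \<alpha>) = \<alpha>"
  have "blocks A \<subseteq> lists A" using assms by (auto simp: blocks_def)
  then have "concat \<alpha> \<in> lists A" using \<alpha> concat_in_lists by blast
  then show "\<alpha> \<in> compress [] ` lists A" using \<alpha> by (metis imageI)
qed

lemma recognizable_compress_lists:
  assumes "finite A" and p: "p \<in> lists A"
  shows "recognizable (compress [] ` lists A)"
proof (rule recognizableI)
  let ?C = "compress [] ` lists A"
  let ?g = "\<lambda>s. {\<alpha> \<in> lists (blocks A). compress s (concat \<alpha>) = s @ \<alpha>}"
  show "finite (insert {} (?g ` short_states A))" using finite_short_states[OF assms(1)] by simp
  fix w
  show "lquot w ?C \<in> insert {} (?g ` short_states A)"
  proof (cases "w \<in> ?C")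
    case True
    then have w: "w \<in> lists (blocks A)" "compress [] (concat w) = w"
      using compress_Nil_concat_iff[OF p] by blast+
    obtain \<delta> s where s: "w = \<delta> @ s" "length s \<le> length p" "\<forall>v. compress w v = \<delta> @ compress s v"
      by (rule compress_locality[of w])
    have "lquot w ?C = {\<alpha> \<in> lists (blocks A). compress w (concat \<alpha>) = w @ \<alpha>}"
      unfolding lquot_def compress_Nil_concat_iff[OF p] using w by (auto simp: compress_append)
    also have "\<dots> = ?g s" using s(1,3) by simp
    finally show ?thesis using w(1) s(1,2) by (auto simp: short_states_def)
  next
    case False
    have "w @ v \<notin> ?C" for v
    proof
      assume "w @ v \<in> ?C"
      then obtain z where z: "z \<in> lists A" "w @ v = compress [] z" by blast
      from prefix_compress[of w z] obtain z' where "prefix z' z" "w = compress [] z'"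
        unfolding z(2)[symmetric] by auto
      then show False using False z(1) by (auto simp: prefix_def)
    qed
    then have "lquot w ?C = {}" by (simp add: lquot_def)
    then show ?thesis by simp
  qed
qed

lemma recognizable_compress_image:
  assumes "finite A" "p \<in> lists A" "N \<subseteq> lists A" "recognizable N"
  shows "recognizable (compress [] ` N)"
proof -
  have "compress [] ` N = compress [] ` lists A \<inter> {\<alpha>. concat \<alpha> \<in> N}"
    using assms(3) by (auto simp: concat_compress)
  then show ?thesis
    using assms(1,2,4)
    by (simp add: recognizable_Int recognizable_compress_lists recognizable_vimage_hom)
qed

end

section \<open>One relation\<close>

lemma maximal_power_suffix:
  assumes "v \<noteq> []"
  shows "\<exists>\<gamma> m. w = \<gamma> @ concat (replicate m v) \<and> \<not> suffix v \<gamma>"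
proof (induction w rule: length_induct)
  case (1 w)
  show ?case
  proof (cases "suffix v w")
    case True
    then obtain w' where w': "w = w' @ v" by (rule suffixE)
    then have "length w' < length w" using assms by simp
    then obtain \<gamma> m where "w' = \<gamma> @ concat (replicate m v)" "\<not> suffix v \<gamma>"
      using 1 by blast
    moreover have "concat (replicate m v) @ v = concat (replicate (Suc m) v)"
      using arg_cong[OF replicate_append_same[of m v], of concat] by simp
    ultimately show ?thesis using w' by (metis append.assoc)
  next
    case False
    then show ?thesis by (intro exI[of _ w] exI[of _ 0]) simp
  qed
qed

locale one_relation =
  fixes A :: "'a set" and v :: "'a list" and c x y :: 'a
  assumes finite_alphabet: "finite A" and lhs_in_lists: "v @ [c] \<in> lists A" and v_nonempty: "v \<noteq> []"
    and rhs_letters: "x \<in> A" "y \<in> A"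
    and unique_normal_forms: "unique_normal_forms (v @ [c]) [x, y]"
    and not_ending_xy: "\<not> suffix [x, y] (v @ [c])"
    and not_power: "c = x \<Longrightarrow> v \<noteq> replicate (length v) y"
begin

sublocale compression v
  using v_nonempty by unfold_locales

abbreviation R :: "('a list \<times> 'a list) set" where
  "R \<equiv> {(v @ [c], [x, y])}"

abbreviation normal :: "'a list \<Rightarrow> bool" where
  "normal w \<equiv> \<not> sublist (v @ [c]) w"

definition codes :: "'a list list set" where
  "codes = compress [] ` {w \<in> lists A. w \<noteq> [] \<and> normal w}"

lemma normal_eqI: "(w, w') \<in> congr_gen R \<Longrightarrow> normal w \<Longrightarrow> normal w' \<Longrightarrow> w = w'"
  using unique_normal_forms unfolding unique_normal_forms_def by (blast intro: congr_gen.refl)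

lemma concat_code: "\<alpha> \<in> codes \<Longrightarrow> concat \<alpha> \<in> lists A \<and> normal (concat \<alpha>) \<and> compress [] (concat \<alpha>) = \<alpha>"
  by (auto simp: codes_def concat_compress)

lemma codes_subset_lists: "codes \<subseteq> lists (blocks A) - {[]}"
proof
  fix \<alpha> assume "\<alpha> \<in> codes"
  then obtain w where w: "w \<in> lists A" "w \<noteq> []" "\<alpha> = compress [] w" by (auto simp: codes_def)
  then have "concat \<alpha> \<noteq> []" by (simp add: concat_compress)
  then show "\<alpha> \<in> lists (blocks A) - {[]}" using w compress_in_lists[of "[]" A w] by auto
qed

lemma codes_prefix_closed:
  assumes "\<alpha> @ \<beta> \<in> codes" "\<alpha> \<noteq> []"
  shows "\<alpha> \<in> codes"
proof -
  obtain w where w: "w \<in> lists A" "normal w" "\<alpha> @ \<beta> = compress [] w"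
    using assms(1) by (auto simp: codes_def)
  then obtain z where z: "prefix z w" "\<alpha> = compress [] z"
    using prefix_compress[of \<alpha> w] by (metis prefixI)
  then have "z \<in> lists A" "normal z" using w(1,2) by (auto simp: prefix_def sublist_append)
  moreover have "z \<noteq> []" using z(2) assms(2) by auto
  ultimately show ?thesis using z(2) by (auto simp: codes_def)
qed

lemma recognizable_codes: "recognizable codes"
proof -
  have "{w \<in> lists A. w \<noteq> [] \<and> normal w}
      = lists A \<inter> - {[]} \<inter> - lconc UNIV (lconc {v @ [c]} UNIV)"
    by (auto simp: sublist_def lconc_def)
  moreover have "recognizable \<dots>"
    by (intro recognizable_Int recognizable_Compl recognizable_lconc recognizable_lists
        recognizable_singleton recognizable_UNIV)
  ultimately show ?thesis
    unfolding codes_def using finite_alphabet lhs_in_lists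
    by (intro recognizable_compress_image) auto
qed

lemma represented_by_code:
  assumes "w \<in> lists A" "w \<noteq> []"
  shows "\<exists>\<alpha>\<in>codes. (w, concat \<alpha>) \<in> congr_gen R"
proof -
  obtain n where n: "(w, n) \<in> congr_gen R" "normal n"
    using unique_normal_forms unfolding unique_normal_forms_def by blast
  have "n \<in> lists A" "n \<noteq> []"
    using congr_gen_in_lists_iff[OF _ n(1), of A] congr_gen_Nil_iff[OF _ n(1)]
      lhs_in_lists rhs_letters assms by auto
  then show ?thesis
    using n by (intro bexI[of _ "compress [] n"]) (auto simp: codes_def concat_compress)
qed

lemma power_congr:
  assumes "c = x \<or> m = 1"
  shows "(concat (replicate m v) @ [c], x # replicate m y) \<in> congr_gen R"
proof (cases "c = x")
  case True
  show ?thesis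
  proof (induction m)
    case (Suc m)
    have "(v @ concat (replicate m v) @ [c], v @ x # replicate m y) \<in> congr_gen R"
      using Suc by (rule congr_gen_append_left)
    moreover have "(v @ x # replicate m y, x # y # replicate m y) \<in> congr_gen R"
      using congr_gen_append_right[OF congr_gen_rule[of "v @ [c]" "[x, y]" R], of "replicate m y"]
        True
      by simp
    ultimately show ?case by (auto intro: congr_gen.trans)
  qed (simp add: True congr_gen.refl)
next
  case False
  then show ?thesis using assms congr_gen_rule[of "v @ [c]" "[x, y]" R] by simp
qed

lemma normal_snoc_iff: "normal (w @ [a]) \<longleftrightarrow> normal w \<and> \<not> suffix (v @ [c]) (w @ [a])"
  by (auto simp: sublist_snoc)

lemma normal_if_ending_xy:
  assumes "normal w" "suffix [x, y] (w @ [y])"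
  shows "normal (w @ [y])"
proof -
  have "2 \<le> length (v @ [c])" using v_nonempty by (cases v) auto
  then have "\<not> suffix (v @ [c]) (w @ [y])"
    using suffix_length_suffix[OF assms(2)] not_ending_xy by auto
  then show ?thesis using assms(1) by (simp add: normal_snoc_iff)
qed

lemma normal_power:
  assumes "normal \<gamma>" "c = x \<Longrightarrow> \<not> suffix v \<gamma>" "c = x \<or> m = 1"
  shows "normal (\<gamma> @ x # replicate m y)"
proof -
  have "normal (\<gamma> @ x # replicate i y)" if "i \<le> m" for i
    using that
  proof (induction i)
    case 0
    have "\<not> suffix (v @ [c]) (\<gamma> @ [x])" using assms(2) by auto
    then show ?case using assms(1) by (simp add: normal_snoc_iff)
  next
    case (Suc i)
    let ?w = "\<gamma> @ x # replicate i y"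
    have "normal ?w" using Suc by simp
    have "normal (?w @ [y])"
    proof (cases "i = 0 \<or> x = y")
      case True
      then have "?w @ [y] = (\<gamma> @ replicate i y) @ [x, y]"
        by (auto simp: replicate_app_Cons_same)
      then have "suffix [x, y] (?w @ [y])" by (rule suffixI)
      then show ?thesis by (rule normal_if_ending_xy[OF \<open>normal ?w\<close>])
    next
      case False
      then have "c = x" using assms(3) Suc.prems by auto
      then have "\<not> suffix (v @ [c]) (?w @ [y])" unfolding snoc_suffix_snoc using False by simp
      then show ?thesis using \<open>normal ?w\<close> normal_snoc_iff by blast
    qed
    then show ?case by (simp add: replicate_append_same)
  qed
  then show ?thesis by blast
qed

lemma reducible_snocE:
  assumes "normal w" "\<not> normal (w @ [a])"
  obtains \<gamma> m where "a = c" "w = \<gamma> @ concat (replicate m v)" "c = x \<or> m = 1"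
    "normal (\<gamma> @ x # replicate m y)"
proof -
  have "a = c" "suffix v w" using assms by (auto simp: normal_snoc_iff)
  obtain \<gamma> m where \<gamma>: "w = \<gamma> @ concat (replicate m v)" "c = x \<Longrightarrow> \<not> suffix v \<gamma>" "c = x \<or> m = 1"
  proof (cases "c = x")
    case True
    then show ?thesis using maximal_power_suffix[OF v_nonempty, of w] that by blast
  next
    case False
    then show ?thesis using that[of _ 1] \<open>suffix v w\<close> by (auto simp: suffix_def)
  qed
  moreover have "normal \<gamma>" using assms(1) by (simp add: \<gamma>(1) sublist_append)
  ultimately show ?thesis using that \<open>a = c\<close> normal_power by blast
qed

definition power_changes :: "'a list list \<Rightarrow> ('a list list \<times> 'a list list) set" where
  "power_changes s =
     {(compress s (concat (replicate m v)), compress s (x # replicate m y)) | m. c = x \<or> m = 1}"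

definition local_changes :: "'a \<Rightarrow> ('a list list \<times> 'a list list) set" where
  "local_changes a = (\<Union>s\<in>short_states A.
     {(s, compress s [a])} \<union> (if a = c then power_changes s else {}))"

lemma local_changes_congr:
  assumes "(s, t) \<in> local_changes a"
  shows "(concat s @ [a], concat t) \<in> congr_gen R"
proof -
  consider "t = compress s [a]"
    | r m where "a = c" "c = x \<or> m = 1" "s = compress r (concat (replicate m v))"
        "t = compress r (x # replicate m y)"
    using assms by (auto simp: local_changes_def power_changes_def split: if_splits)
  then show ?thesis
  proof cases
    case 1
    then show ?thesis by (simp only: concat_compress congr_gen.refl)
  next
    case 2
    show ?thesis
      using congr_gen_append_left[OF power_congr[OF 2(2)], of "concat r"]
      unfolding 2(1,3,4) concat_compress by simp
  qed
qed

lemma compress_right_mult: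
  assumes "w \<in> lists A" "normal w" "normal w'" "(w @ [a], w') \<in> congr_gen R"
  shows "(compress [] w, compress [] w') \<in> common_prefix_closure (local_changes a)"
proof (cases "normal (w @ [a])")
  case True
  then have "w' = w @ [a]" using normal_eqI[OF assms(4)] assms(3) by simp
  obtain s where s: "s \<in> short_states A" "\<And>z z' T. (compress s z, compress s z') \<in> T
      \<Longrightarrow> (compress [] (w @ z), compress [] (w @ z')) \<in> common_prefix_closure T"
    by (rule compress_common_prefix[OF assms(1)]) blast
  then have "(compress s [], compress s [a]) \<in> local_changes a" by (auto simp: local_changes_def)
  from s(2)[OF this] show ?thesis using \<open>w' = w @ [a]\<close> by simp
next
  case False
  obtain \<gamma> m where \<gamma>: "a = c" "w = \<gamma> @ concat (replicate m v)" "c = x \<or> m = 1"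
      "normal (\<gamma> @ x # replicate m y)"
    by (rule reducible_snocE[OF assms(2) False])
  have "(w @ [a], \<gamma> @ x # replicate m y) \<in> congr_gen R"
    using congr_gen_append_left[OF power_congr[OF \<gamma>(3)], of \<gamma>] \<gamma>(1,2) by simp
  then have "w' = \<gamma> @ x # replicate m y"
    using normal_eqI[OF _ assms(3) \<gamma>(4)] assms(4) by (blast intro: congr_gen.trans congr_gen.sym)
  have "\<gamma> \<in> lists A" using assms(1) \<gamma>(2) by simp
  then obtain s where s: "s \<in> short_states A" "\<And>z z' T. (compress s z, compress s z') \<in> T
      \<Longrightarrow> (compress [] (\<gamma> @ z), compress [] (\<gamma> @ z')) \<in> common_prefix_closure T"
    by (rule compress_common_prefix) blast
  have "(compress s (concat (replicate m v)), compress s (x # replicate m y)) \<in> local_changes a"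
    using s(1) \<gamma>(1,3) by (auto simp: local_changes_def power_changes_def)
  from s(2)[OF this] show ?thesis by (simp only: \<gamma>(2) \<open>w' = \<gamma> @ x # replicate m y\<close>)
qed

lemma right_mult_rel_codes:
  "right_mult_rel R codes [a] = (codes \<times> codes) \<inter> common_prefix_closure (local_changes a)"
proof (intro equalityI subrelI)
  fix \<alpha> \<beta> assume "(\<alpha>, \<beta>) \<in> right_mult_rel R codes [a]"
  then have \<alpha>\<beta>: "\<alpha> \<in> codes" "\<beta> \<in> codes" "(concat \<alpha> @ [a], concat \<beta>) \<in> congr_gen R"
    by (simp_all add: right_mult_rel_def)
  then have "(compress [] (concat \<alpha>), compress [] (concat \<beta>))
      \<in> common_prefix_closure (local_changes a)"
    using concat_code by (blast intro: compress_right_mult)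
  then show "(\<alpha>, \<beta>) \<in> (codes \<times> codes) \<inter> common_prefix_closure (local_changes a)"
    using \<alpha>\<beta>(1,2) concat_code by simp
next
  fix \<alpha> \<beta> assume "(\<alpha>, \<beta>) \<in> (codes \<times> codes) \<inter> common_prefix_closure (local_changes a)"
  then obtain \<delta> s t where "\<alpha> = \<delta> @ s" "\<beta> = \<delta> @ t" "\<alpha> \<in> codes" "\<beta> \<in> codes" "(s, t) \<in> local_changes a"
    unfolding common_prefix_closure_def by blast
  then show "(\<alpha>, \<beta>) \<in> right_mult_rel R codes [a]"
    using congr_gen_append_left[OF local_changes_congr, of s t a "concat \<delta>"]
    by (simp add: right_mult_rel_def)
qed

lemma right_mult_rel_codes_Nil: "right_mult_rel R codes [] = (codes \<times> codes) \<inter> Id"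
proof (intro equalityI subrelI)
  fix \<alpha> \<beta> assume "(\<alpha>, \<beta>) \<in> right_mult_rel R codes []"
  then have \<alpha>\<beta>: "\<alpha> \<in> codes" "\<beta> \<in> codes" "(concat \<alpha>, concat \<beta>) \<in> congr_gen R"
    by (simp_all add: right_mult_rel_def)
  then have "concat \<alpha> = concat \<beta>" using normal_eqI concat_code by blast
  then have "\<alpha> = \<beta>" using concat_code \<alpha>\<beta>(1,2) by metis
  then show "(\<alpha>, \<beta>) \<in> (codes \<times> codes) \<inter> Id" using \<alpha>\<beta> by simp
qed (auto simp: right_mult_rel_def congr_gen.refl)

lemma automatic_rel_power_changes: "automatic_rel (power_changes s)"
proof (cases "c = x")
  case True
  have "automatic_rel (range (\<lambda>m. (compress s (concat (replicate m v)),
      compress (compress_step s x) (replicate m y))))"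
    using eventually_pumped_compress_power
      eventually_pumped_compress_letter_power[OF not_power[OF True]]
    by (rule automatic_rel_if_pumped)
  moreover have "power_changes s = range (\<lambda>m. (compress s (concat (replicate m v)),
      compress (compress_step s x) (replicate m y)))"
    unfolding power_changes_def using True by auto
  ultimately show ?thesis by simp
next
  case False
  then show ?thesis by (intro automatic_rel_finite) (simp add: power_changes_def)
qed

lemma automatic_rel_local_changes: "automatic_rel (local_changes a)"
  unfolding local_changes_def
  by (intro automatic_rel_UNION automatic_rel_Un finite_short_states finite_alphabet)
    (simp_all add: automatic_rel_finite automatic_rel_power_changes)

sublocale word_coding A R "blocks A" codes
proof
  show "finite (blocks A)" "blocks A \<subseteq> lists A - {[]}"
    using finite_alphabet lhs_in_lists block_nonempty by (auto simp: blocks_def)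
  show "automatic_rel (right_mult_rel R codes [])"
    unfolding right_mult_rel_codes_Nil
    by (intro automatic_rel_Int automatic_rel_Times recognizable_codes automatic_rel_Id)
  show "automatic_rel (right_mult_rel R codes [a])" for a
    unfolding right_mult_rel_codes
    by (intro automatic_rel_Int automatic_rel_Times recognizable_codes
        automatic_rel_common_prefix_closure automatic_rel_local_changes)
qed (fact codes_subset_lists recognizable_codes represented_by_code)+

end

lemma automatic_if_unique_normal_forms:
  fixes A :: "nat set"
  assumes "finite A" "0 \<notin> A" and U: "U \<in> lists A" "2 \<le> length U" and xy: "x \<in> A" "y \<in> A"
    and "unique_normal_forms U [x, y]" "\<not> suffix [x, y] U" "U \<noteq> replicate (length U - 1) y @ [x]"
  shows "automatic (sgp_carrier A {(U, [x, y])}) (sgp_mult A {(U, [x, y])}) \<and>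
    prefix_automatic (sgp_carrier (one_alph A) (one_rels A {(U, [x, y])}))
                     (sgp_mult (one_alph A) (one_rels A {(U, [x, y])}))"
proof -
  obtain v c where v: "U = v @ [c]" "v \<noteq> []"
    using U(2) by (cases U rule: rev_cases) (auto simp: Suc_le_eq)
  interpret one_relation A v c x y
    by unfold_locales (use assms v in auto)
  interpret identity_adjunction A R "blocks A" codes
    by unfold_locales (use assms v in auto)
  show ?thesis
    using automatic prefix_automatic_one_if_prefix_closed[OF codes_prefix_closed] v(1) by simp
qed

lemma congr_gen_swap: "congr_gen (insert (v, w) Q) = congr_gen (insert (w, v) Q)"
proof -
  have "congr_gen (insert (v, w) Q) \<subseteq> congr_gen (insert (w, v) Q)" for v w
    by (rule congr_gen_subsetI) (auto intro: congr_gen_rule congr_gen.sym)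
  then show ?thesis by blast
qed

lemma sgp_cong:
  assumes "congr_gen Q = congr_gen Q'"
  shows "sgp_carrier A Q = sgp_carrier A Q'" "sgp_mult A Q = sgp_mult A Q'"
  using assms by (simp_all add: sgp_carrier_def sgp_mult_def cls_def fun_eq_iff)

lemma sgp_swap:
  "sgp_carrier A {(v, w)} = sgp_carrier A {(w, v)}" "sgp_mult A {(v, w)} = sgp_mult A {(w, v)}"
  "sgp_carrier A' (one_rels A {(v, w)}) = sgp_carrier A' (one_rels A {(w, v)})"
  "sgp_mult A' (one_rels A {(v, w)}) = sgp_mult A' (one_rels A {(w, v)})"
  unfolding one_rels_def Un_insert_left Un_empty_left
  by (rule sgp_cong, rule congr_gen_swap)+

lemma automatic_if_unique_normal_forms_reversed:
  fixes A :: "nat set"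
  assumes "finite A" "0 \<notin> A" and "[b, d] \<in> lists A" "[x, y] \<in> lists A"
    and "unique_normal_forms [x, y] [b, d]" and "[b, d] \<noteq> [x, y]" "[b, d] \<noteq> [y, x]"
  shows "automatic (sgp_carrier A {([b, d], [x, y])}) (sgp_mult A {([b, d], [x, y])}) \<and>
    prefix_automatic (sgp_carrier (one_alph A) (one_rels A {([b, d], [x, y])}))
                     (sgp_mult (one_alph A) (one_rels A {([b, d], [x, y])}))"
  unfolding sgp_swap[where v = "[b, d]"]
  by (rule automatic_if_unique_normal_forms)
    (use assms in \<open>auto simp: suffix_def Cons_eq_append_conv\<close>)

theorem theorem3p1p6:
  fixes n k x y :: nat and u :: "nat list"
  assumes "k \<ge> 2" and "length u = k" and "set u \<subseteq> {1..n}"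
    and "x \<in> {1..n}" and "y \<in> {1..n}"
    and "\<exists>\<rho>. inj_on \<rho> {1..n} \<and>
           GSB \<rho> {1..n} {(\<lambda>w. (if w = u then 1 else 0) - (if w = [x, y] then 1 else 0))
                            :: nat list \<Rightarrow> 'k::field}"
    and "drop (k - 2) u \<noteq> [x, y]"
    and "u \<noteq> replicate (k - 1) y @ [x]"
  shows "automatic (sgp_carrier {1..n} {(u, [x, y])}) (sgp_mult {1..n} {(u, [x, y])}) \<and>
         prefix_automatic (sgp_carrier (one_alph {1..n}) (one_rels {1..n} {(u, [x, y])}))
                          (sgp_mult (one_alph {1..n}) (one_rels {1..n} {(u, [x, y])}))"
proof -
  have lists: "u \<in> lists {1..n}" "[x, y] \<in> lists {1..n}" using assms(3-5) by auto
  obtain \<rho> where \<rho>: "GSB \<rho> {1..n}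
      {(\<lambda>w. (if w = u then 1 else 0) - (if w = [x, y] then 1 else 0)) :: nat list \<Rightarrow> 'k}"
    using assms(6) by blast
  from \<rho> lists show ?thesis
  proof (cases rule: GSB_difference_cases)
    case decreasing
    have "\<not> suffix [x, y] u" using assms(2,7) by (auto simp: suffix_def)
    then show ?thesis
      using assms decreasing(2) by (intro automatic_if_unique_normal_forms) auto
  next
    case increasing
    \<comment> \<open>Only possible for \<open>k = 2\<close> and in characteristic 2; both hypotheses on \<open>u\<close> are symmetric
      in \<open>u\<close> and \<open>xy\<close> then.\<close>
    then have "k = 2" using assms(1,2) by (auto simp: dlex_less_def)
    then obtain b d where u: "u = [b, d]"
      using assms(2) by (auto simp: length_Suc_conv numeral_2_eq_2)
    show ?thesis
      unfolding u by (rule automatic_if_unique_normal_forms_reversed)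
        (use assms(7,8) increasing(2) lists u \<open>k = 2\<close> in auto)
  qed
qed

end
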